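(* Let $\cdot$ all objects be as in the context: $\mathcal{X}\subseteq\mathbb{R}^d$ is a nonempty closed convex set with diameter at most $D>0$, $g\colon\mathbb{R}^d\to\mathbb{R}$ is a Lipschitz convex function accessed through a stochastic subgradient oracle $G$ satisfying (A1), (A2), (A3) with constant $L\ge 0$, and $\varphi$ equals $g$ on $\mathcal{X}$ and $+\infty$ off $\mathcal{X}$. Let $\rho>0$ be a fixed constant and let $\varepsilon$ be a target accuracy with $0<\varepsilon\le 2\rho D$. Set $$\mu:=\frac{\varepsilon}{2D},\qquad \lambda:=2\rho-\frac{\varepsilon}{2D},\qquad \mathcal{I}:=\log_2\left(\frac34+\frac{\rho D}{\varepsilon}\right),$$ and assume that $\mathcal{I}$ is an integer. Then for every integer $T>0$ and every $x_{\rm c}\in\mathcal{X}$, the procedure $\mathrm{GR}(x_{\rm c},\mu,\lambda,T,\mathcal{I},G)$ (gradual regularization for non-strongly convex problems, described in the context) returns a point $\bar z$ satisfying $$\mathbb{E}\|\nabla\varphi_{1/(2\rho)}(\bar z)\|\le \frac{\left(28\sqrt2\cdot\log_2\left(\tfrac34+\tfrac{\rho D}{\varepsilon}\right)\right)\cdot\sqrt{2L^2+3\rho^2D^2}}{\sqrt{T+1}}+\frac{\varepsilon}{2}.$$ Consequently (setting the right-hand side to $\varepsilon$ and solving for $T$), it suffices to make $$O\left(\frac{\log^3\left(\frac{\rho D}{\varepsilon}\right)\,(L^2+\rho^2D^2)}{\varepsilon^2}\right)$$ calls to $\mathrm{proj}_{\mathcal{X}}$ and to the stochastic subgradient oracle,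 with an absolute constant hidden in $O(\cdot)$, in order to find a point $\bar z\in\mathcal{X}$ satisfying $\mathbb{E}\|\nabla\varphi_{1/(2\rho)}(\bar z)\|\le\varepsilon$.
   Context: **Problem.** $\mathcal{X}\subseteq\mathbb{R}^d$ is a nonempty closed convex set whose diameter is bounded by $D>0$, with nearest-point map $\mathrm{proj}_{\mathcal{X}}$; $g\colon\mathbb{R}^d\to\mathbb{R}$ is convex and Lipschitz. The function $\varphi\colon\mathbb{R}^d\to\mathbb{R}\cup\{+\infty\}$ equals $g$ on $\mathcal{X}$ and $+\infty$ off $\mathcal{X}$. $\|\cdot\|$ is the Euclidean norm. **Stochastic subgradient oracle.** Fix a probability space $(\Omega,\mathcal{F},P)$ and equip $\mathbb{R}^d$ with the Borel $\sigma$-algebra. (A1) One can generate i.i.d. realizations $\xi_1,\xi_2,\ldots\sim dP$. (A2) There is an open set $U\supseteq\mathcal{X}$ and a measurable map $G\colon U\times\Omega\to\mathbb{R}^d$ with $\mathbb{E}_\xi[G(x,\xi)]\in\partial g(x)$ for all $x\in U$. (A3) There is a real $L\ge0$ with $\mathbb{E}_\xi[\|G(x,\xi)\|^2]\le L^2$ for all $x\in\mathcal{X}$. A call to the oracle means sampling a fresh $\xi\sim dP$ and evaluating $G(x,\xi)$. Expectations $\mathbb{E}$ are over all samples drawn. **Moreau envelope.** For $\lambda>0$, $\varphi_\lambda(x)=\min_{y}\{\varphi(y)+\frac1{2\lambda}\|y-x\|^2\}$, a $C^1$-smooth function. (So $\varphi_{1/(2\rho)}$ is the envelope with parameter $1/(2\rho)$.)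 **Procedure $\mathrm{PSSM}^{\rm sc}(x_0,\mu,G,T)$** (projected stochastic subgradient method; $x_0\in\mathcal{X}$, $\mu>0$, $T\in\mathbb{N}$ positive). For $t=0,\ldots,T-2$: sample $\xi_t\sim dP$ (fresh, independent) and set $x_{t+1}=\mathrm{proj}_{\mathcal{X}}\left(x_t-\frac{2}{\mu(t+1)}G(x_t,\xi_t)\right)$. Return $\frac{2}{T(T+1)}\sum_{t=0}^{T-1}(t+1)x_t$. **Procedure $\mathrm{GR}^{\rm sc}(x_0,\mu,\lambda,T,\mathcal{I},G)$** (gradual regularization for strongly convex problems; $x_0\in\mathcal{X}$, $\mu,\lambda>0$, $T,\mathcal{I}\in\mathbb{N}$ positive). Set $G^{(0)}=G$, $\hat x_0=x_0$, $\mu_0=\mu$. For $i=0,\ldots,\mathcal{I}$: set $\hat x_{i+1}=\mathrm{PSSM}^{\rm sc}(\hat x_i,\sum_{j=0}^i\mu_j,G^{(i)},T)$; set $\mu_{i+1}=\mu\cdot2^{i+1}$; define the oracle $G^{(i+1)}(x,\xi):=G^{(i)}(x,\xi)+\mu_{i+1}(x-\hat x_{i+1})$. Return $\bar x=\frac{1}{\lambda+\sum_{i=1}^{\mathcal{I}}\mu_i}\left(\lambda\hat x_{\mathcal{I}+1}+\sum_{i=1}^{\mathcal{I}}\mu_i\hat x_i\right)$. **Procedure $\mathrm{GR}(x_{\rm c},\mu,\lambda,T,\mathcal{I},G)$** (gradual regularization for non-strongly convex problems; $x_{\rm c}\in\mathcal{X}$). Set $\widehat G(x,\xi)=G(x,\xi)+\mu(x-x_{\rm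 c})$, an oracle for $\widehat\varphi(x)=\varphi(x)+\frac\mu2\|x-x_{\rm c}\|^2$. Set $\bar x=\mathrm{GR}^{\rm sc}(x_{\rm c},\mu,\lambda/2,T,\mathcal{I},\widehat G)$. Return $\bar z=\frac{\mu}{\mu+\lambda}x_{\rm c}+\frac{\lambda}{\mu+\lambda}\bar x$. *)

theory Defs
  imports "HOL-Probability.Probability"
begin

definition subdifferential :: "('a::real_inner \<Rightarrow> real) \<Rightarrow> 'a \<Rightarrow> 'a set" where
  "subdifferential g x = {v. \<forall>y. g y \<ge> g x + v \<bullet> (y - x)}"

definition restrict_to :: "'a set \<Rightarrow> ('a \<Rightarrow> real) \<Rightarrow> 'a \<Rightarrow> ereal" where
  "restrict_to X g x = (if x \<in> X then ereal (g x) else \<infinity>)"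

definition moreau_envelope :: "real \<Rightarrow> ('a::real_normed_vector \<Rightarrow> ereal) \<Rightarrow> 'a \<Rightarrow> ereal" where
  "moreau_envelope l \<phi> x = (INF y. \<phi> y + ereal (1 / (2 * l) * (norm (y - x))\<^sup>2))"

definition grad :: "('a::real_inner \<Rightarrow> real) \<Rightarrow> 'a \<Rightarrow> 'a" where
  "grad f x = (THE v. GDERIV f x :> v)"

text \<open>
  An oracle is a map from a query point and a sample to a vector. The procedures read their
  samples from an infinite sequence \<open>w\<close>; a random run is obtained by letting \<open>w\<close> be a sequence of
  i.i.d. random samples. Every procedure threads a pair of counters: the number of projections and
  the number of oracle calls performed so far. The second counter is also the index of the next
  unread entry of \<open>w\<close>, so that every oracle call uses a fresh sample. One call to a shifted oracle
  \<open>\<lambda>y v. G y v + c y\<close> is one call to \<open>G\<close>.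
\<close>

type_synonym counters = "nat \<times> nat"

primrec pssm_iter ::
  "'a::euclidean_space set \<Rightarrow> 'a \<Rightarrow> real \<Rightarrow> ('a \<Rightarrow> 'w \<Rightarrow> 'a) \<Rightarrow> (nat \<Rightarrow> 'w) \<Rightarrow> counters \<Rightarrow> nat
    \<Rightarrow> 'a \<times> counters" where
  "pssm_iter X x0 \<mu> G w c 0 = (x0, c)"
| "pssm_iter X x0 \<mu> G w c (Suc t) =
    (case pssm_iter X x0 \<mu> G w c t of (x, p, n) \<Rightarrow>
      (closest_point X (x - (2 / (\<mu> * (real t + 1))) *\<^sub>R G x (w n)), p + 1, n + 1))"

text \<open>The output averages the \<open>T\<close> iterates with indices \<open>0, \<dots>, T - 1\<close>, which takes \<open>T - 1\<close> steps.\<close>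

definition pssm_sc ::
  "'a::euclidean_space set \<Rightarrow> 'a \<Rightarrow> real \<Rightarrow> ('a \<Rightarrow> 'w \<Rightarrow> 'a) \<Rightarrow> nat \<Rightarrow> (nat \<Rightarrow> 'w) \<Rightarrow> counters
    \<Rightarrow> 'a \<times> counters" where
  "pssm_sc X x0 \<mu> G T w c =
    ((2 / (real T * (real T + 1))) *\<^sub>R
       (\<Sum>t<T. (real t + 1) *\<^sub>R fst (pssm_iter X x0 \<mu> G w c t)),
     snd (pssm_iter X x0 \<mu> G w c (T - 1)))"

text \<open>
  \<open>gr_sc_iter X x0 \<mu> G T w c i\<close> is the \<open>i\<close>-th outer iterate together with the \<open>i\<close>-th oracle and the
  current counters. The weights are \<open>\<mu>\<^sub>j = \<mu> * 2 ^ j\<close>, also for \<open>j = 0\<close>.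
\<close>

primrec gr_sc_iter ::
  "'a::euclidean_space set \<Rightarrow> 'a \<Rightarrow> real \<Rightarrow> ('a \<Rightarrow> 'w \<Rightarrow> 'a) \<Rightarrow> nat \<Rightarrow> (nat \<Rightarrow> 'w) \<Rightarrow> counters \<Rightarrow> nat
    \<Rightarrow> 'a \<times> ('a \<Rightarrow> 'w \<Rightarrow> 'a) \<times> counters" where
  "gr_sc_iter X x0 \<mu> G T w c 0 = (x0, G, c)"
| "gr_sc_iter X x0 \<mu> G T w c (Suc i) =
    (case gr_sc_iter X x0 \<mu> G T w c i of (x, H, k) \<Rightarrow>
      (case pssm_sc X x (\<Sum>j\<le>i. \<mu> * 2 ^ j) H T w k of (x', k') \<Rightarrow>
        (x', \<lambda>y v. H y v + (\<mu> * 2 ^ (i + 1)) *\<^sub>R (y - x'), k')))"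

definition gr_sc ::
  "'a::euclidean_space set \<Rightarrow> 'a \<Rightarrow> real \<Rightarrow> real \<Rightarrow> nat \<Rightarrow> nat \<Rightarrow> ('a \<Rightarrow> 'w \<Rightarrow> 'a) \<Rightarrow> (nat \<Rightarrow> 'w)
    \<Rightarrow> counters \<Rightarrow> 'a \<times> counters" where
  "gr_sc X x0 \<mu> l T I G w c =
    ((1 / (l + (\<Sum>i=1..I. \<mu> * 2 ^ i))) *\<^sub>R
       (l *\<^sub>R fst (gr_sc_iter X x0 \<mu> G T w c (I + 1))
        + (\<Sum>i=1..I. (\<mu> * 2 ^ i) *\<^sub>R fst (gr_sc_iter X x0 \<mu> G T w c i))),
     snd (snd (gr_sc_iter X x0 \<mu> G T w c (I + 1))))"

definition gr ::
  "'a::euclidean_space set \<Rightarrow> 'a \<Rightarrow> real \<Rightarrow> real \<Rightarrow> nat \<Rightarrow> nat \<Rightarrow> ('a \<Rightarrow> 'w \<Rightarrow> 'a) \<Rightarrow> (nat \<Rightarrow> 'w)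
    \<Rightarrow> 'a \<times> counters" where
  "gr X xc \<mu> l T I G w =
    (case gr_sc X xc \<mu> (l / 2) T I (\<lambda>y v. G y v + \<mu> *\<^sub>R (y - xc)) w (0, 0) of (x, k) \<Rightarrow>
      ((\<mu> / (\<mu> + l)) *\<^sub>R xc + (l / (\<mu> + l)) *\<^sub>R x, k))"

definition gr_bound :: "real \<Rightarrow> real \<Rightarrow> real \<Rightarrow> real \<Rightarrow> nat \<Rightarrow> real" where
  "gr_bound L D \<rho> \<epsilon> T =
    (28 * sqrt 2 * log 2 (3/4 + \<rho> * D / \<epsilon>)) * sqrt (2 * L\<^sup>2 + 3 * \<rho>\<^sup>2 * D\<^sup>2) / sqrt (real T + 1)
    + \<epsilon> / 2"

text \<open>
  The number of inner steps obtained by solving \<open>gr_bound L D \<rho> \<epsilon> T = \<epsilon>\<close> for \<open>T\<close>, rounded to a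
  positive integer. It depends on the four real parameters only, so a constant in an estimate of it
  is independent of the dimension, the constraint set, the objective and the probability space.
\<close>

definition gr_horizon :: "real \<Rightarrow> real \<Rightarrow> real \<Rightarrow> real \<Rightarrow> nat" where
  "gr_horizon L D \<rho> \<epsilon> = (LEAST T. 0 < T \<and> gr_bound L D \<rho> \<epsilon> T \<le> \<epsilon>)"

end

theory Submission
  imports Defs
begin

text \<open>
  Put \<open>m\<^sub>i = \<mu> * (2 ^ (i + 1) - 1)\<close>. Stage \<open>i\<close> of the outer loop works on the \<open>m\<^sub>i\<close>-strongly convex function
  \<open>f\<^sub>i\<close> that arises from \<open>g\<close> by adding the quadratic of weight \<open>\<mu>\<close> centred at \<open>xc\<close> and, for each
  \<open>1 \<le> j \<le> i\<close>, the quadratic of weight \<open>\<mu> * 2 ^ j\<close> centred at the \<open>j\<close>-th outer iterate. The parameters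
  are chosen such that after a last, virtual quadratic of weight \<open>l / 2\<close> centred at the last iterate
  the total weight is \<open>2 * \<rho>\<close>, and the output \<open>z\<close> is the weighted mean of all centres (\<open>gr_eq\<close>). So the
  minimiser \<open>p\<close> of the final function over \<open>X\<close> is the proximal point of \<open>z\<close>, and the gradient of the
  Moreau envelope at \<open>z\<close> is \<open>2 * \<rho> * (z - p)\<close> (\<open>grad_moreau_envelope\<close>). In other words, it is the sum
  over all quadratics of weight times centre minus \<open>p\<close>, a quantity called the residual here.

  The residual is followed through the stages. Before any iterate is added it has norm at most
  \<open>\<mu> * D = \<epsilon> / 2\<close>. Adding the quadratic of weight \<open>n\<close> centred at an iterate \<open>x\<close> to a function whose
  minimiser is \<open>a\<close> moves the minimiser towards \<open>x\<close> and by at most \<open>norm (x - a)\<close>, so the residual grows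
  by at most the new total weight times \<open>norm (x - a)\<close> (\<open>prox_drift\<close>, \<open>residual_growth\<close>).

  It remains to bound the distance of the average returned by the projected subgradient method in
  stage \<open>i\<close> from the minimiser of \<open>f\<^sub>i\<close>. The shifted oracle has mean square at most \<open>B\<^sup>2 = 2 * L\<^sup>2 + 3 * \<rho>\<^sup>2 * D\<^sup>2\<close> on
  \<open>X\<close>. Strong monotonicity and nonexpansiveness of the projection give a recursion for the mean square
  distance that telescopes after weighting with \<open>(t + 1)\<^sup>2\<close>, and the expected distance of the average
  is at most \<open>2 * B / (m\<^sub>i * sqrt (T + 1))\<close> (\<open>average_error\<close>). Since \<open>m\<^sub>i\<close> grows by a factor of at most
  \<open>3\<close> per stage, each stage adds at most \<open>6 * B / sqrt (T + 1)\<close> to the expected residual, and the last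
  quadratic adds at most \<open>4 * B / sqrt (T + 1)\<close> (\<open>final_residual\<close>). The sum \<open>6 * I + 4\<close> is below
  \<open>28 * sqrt 2 * I\<close> because \<open>I \<ge> 1\<close>.

  All of this takes place inside expectations. Each iterate and each minimiser depends on earlier
  samples only, and a fresh sample is independent of these, so that the conditions on the oracle can be
  applied for fixed past (\<open>fresh_distr\<close>). For the number of oracle calls, the required \<open>T\<close> is of order
  \<open>I\<^sup>2 * B\<^sup>2 / \<epsilon>\<^sup>2\<close>, there are \<open>I + 1\<close> stages, and \<open>I\<close> is at most a constant times
  \<open>ln (\<rho> * D / \<epsilon>)\<close> (\<open>complexity_bound\<close>).
\<close>

section \<open>Minimisers of quadratically regularised objectives\<close>

lemma norm_add_sq:
  fixes u v :: "'a::real_inner"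
  shows "(norm (u + v))\<^sup>2 = (norm u)\<^sup>2 + 2 * (u \<bullet> v) + (norm v)\<^sup>2"
  by (simp add: power2_norm_eq_inner inner_add_left inner_add_right inner_commute[of v u])

lemma norm_diff_sq:
  fixes u v :: "'a::real_inner"
  shows "(norm (u - v))\<^sup>2 = (norm u)\<^sup>2 - 2 * (u \<bullet> v) + (norm v)\<^sup>2"
  by (simp add: power2_norm_eq_inner inner_diff_left inner_diff_right inner_commute[of v u])


text \<open>
  This point minimises \<open>g x + m / 2 * x \<bullet> x - b \<bullet> x\<close> over \<open>X\<close>, that is,
  \<open>g x + m / 2 * (norm (x - b / m))\<^sup>2\<close>; so it is the proximal point of \<open>b / m\<close> with parameter
  \<open>1 / m\<close>. It is described by its first-order condition, because that is the form in which it is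
  used throughout. Parametrising by \<open>b\<close> instead of the centre \<open>b / m\<close> makes the addition of a further
  quadratic \<open>n / 2 * (norm (x - y))\<^sup>2\<close> to the objective the addition of \<open>n\<close> to \<open>m\<close> and of
  \<open>n *\<^sub>R y\<close> to \<open>b\<close>.
\<close>

definition reg_min :: "'a::euclidean_space set \<Rightarrow> ('a \<Rightarrow> real) \<Rightarrow> real \<Rightarrow> 'a \<Rightarrow> 'a" where
  "reg_min X g m b = (SOME a. a \<in> X \<and> (\<forall>y\<in>X. g a + (b - m *\<^sub>R a) \<bullet> (y - a) \<le> g y))"

text \<open>
  A minimiser \<open>a\<close> exists by compactness. Comparing it with \<open>a + t *\<^sub>R (y - a)\<close>, using convexity of \<open>g\<close>,
  dividing by \<open>t\<close> and letting \<open>t\<close> tend to \<open>0\<close> turns minimality into the first-order condition.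
\<close>

lemma regularised_minimiser_exists:
  fixes X :: "'a::euclidean_space set"
  assumes X: "X \<noteq> {}" "compact X" "convex X"
    and g: "convex_on UNIV g" "continuous_on X g" and m: "0 \<le> m"
  shows "\<exists>a\<in>X. \<forall>y\<in>X. g a + (b - m *\<^sub>R a) \<bullet> (y - a) \<le> g y"
proof -
  define f where "f = (\<lambda>x. g x + m / 2 * (x \<bullet> x) - b \<bullet> x)"
  have "continuous_on X f"
    unfolding f_def by (intro continuous_intros g)
  from continuous_attains_inf[OF X(2,1) this]
  obtain a where a: "a \<in> X" and min: "\<And>y. y \<in> X \<Longrightarrow> f a \<le> f y" by blast
  have "g a + (b - m *\<^sub>R a) \<bullet> (y - a) \<le> g y" if y: "y \<in> X" for y
  proof -
    define d where "d = y - a"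
    have step: "g a + b \<bullet> d - m * (a \<bullet> d) \<le> g y + t * (m / 2 * (d \<bullet> d))"
      if t: "0 < t" "t < 1" for t
    proof -
      have eq: "a + t *\<^sub>R d = (1 - t) *\<^sub>R a + t *\<^sub>R y"
        by (simp add: d_def algebra_simps)
      have "a + t *\<^sub>R d \<in> X"
        unfolding eq using X(3) a y t by (auto simp: convex_alt)
      then have "f a \<le> f (a + t *\<^sub>R d)" by (rule min)
      moreover have "g (a + t *\<^sub>R d) \<le> (1 - t) * g a + t * g y"
        unfolding eq using t g(1) by (intro convex_onD) auto
      moreover have "f (a + t *\<^sub>R d)
          = g (a + t *\<^sub>R d) + m / 2 * (a \<bullet> a + 2 * t * (a \<bullet> d) + t * t * (d \<bullet> d)) - b \<bullet> a - t * (b \<bullet> d)"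
        by (simp add: f_def inner_add_left inner_add_right inner_commute[of d a] algebra_simps)
      moreover have "f a = g a + m / 2 * (a \<bullet> a) - b \<bullet> a"
        by (simp add: f_def)
      ultimately have "0 \<le> t * (g y + t * (m / 2 * (d \<bullet> d)) - (g a + b \<bullet> d - m * (a \<bullet> d)))"
        by (simp add: algebra_simps)
      with t show ?thesis by (simp add: zero_le_mult_iff)
    qed
    have "((\<lambda>t. g y + t * (m / 2 * (d \<bullet> d))) \<longlongrightarrow> g y + 0 * (m / 2 * (d \<bullet> d))) (at_right (0::real))"
      by (intro tendsto_intros)
    moreover have "\<forall>\<^sub>F t in at_right (0::real). g a + b \<bullet> d - m * (a \<bullet> d) \<le> g y + t * (m / 2 * (d \<bullet> d))"
      by (rule eventually_mono[OF eventually_at_right_real[of 0 1]]) (auto dest: step)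
    ultimately have "g a + b \<bullet> d - m * (a \<bullet> d) \<le> g y + 0 * (m / 2 * (d \<bullet> d))"
      by (intro tendsto_le[OF _ _ tendsto_const]) auto
    then show ?thesis by (simp add: d_def inner_simps algebra_simps)
  qed
  with a show ?thesis by blast
qed

locale constrained_problem =
  fixes X :: "'a::euclidean_space set" and g :: "'a \<Rightarrow> real" and D :: real
  assumes X: "X \<noteq> {}" "closed X" "convex X" "bounded X" "diameter X \<le> D" "0 < D"
    and g: "convex_on UNIV g" "continuous_on UNIV g"
begin

abbreviation prox where "prox \<equiv> reg_min X g"

lemma dist_le: "x \<in> X \<Longrightarrow> y \<in> X \<Longrightarrow> norm (x - y) \<le> D"
  using diameter_bounded_bound[OF X(4), of x y] X(5) by (simp add: dist_norm)

lemma prox_spec: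
  assumes "0 \<le> m"
  shows prox_in: "prox m b \<in> X"
    and prox_subgradient: "\<And>y. y \<in> X \<Longrightarrow> g (prox m b) + (b - m *\<^sub>R prox m b) \<bullet> (y - prox m b) \<le> g y"
proof -
  have "\<exists>a. a \<in> X \<and> (\<forall>y\<in>X. g a + (b - m *\<^sub>R a) \<bullet> (y - a) \<le> g y)"
    using regularised_minimiser_exists[of X g m b] X g assms
    by (auto simp: compact_eq_bounded_closed intro: continuous_on_subset)
  from someI_ex[OF this] show "prox m b \<in> X"
    "\<And>y. y \<in> X \<Longrightarrow> g (prox m b) + (b - m *\<^sub>R prox m b) \<bullet> (y - prox m b) \<le> g y"
    unfolding reg_min_def by auto
qed

text \<open>
  The vector \<open>b - m *\<^sub>R prox m b\<close> is a subgradient at \<open>prox m b\<close> of \<open>g\<close> restricted to \<open>X\<close>, and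
  subgradients of a convex function are monotone. All quantitative facts about \<open>prox\<close> follow from
  this inequality.
\<close>

lemma prox_monotone:
  assumes "0 \<le> m" "0 \<le> m'"
  shows "0 \<le> ((b' - m' *\<^sub>R prox m' b') - (b - m *\<^sub>R prox m b)) \<bullet> (prox m' b' - prox m b)"
  using prox_subgradient[OF assms(1) prox_in[OF assms(2), of b'], of b]
    prox_subgradient[OF assms(2) prox_in[OF assms(1), of b], of b']
  by (simp add: inner_diff_left inner_diff_right)

lemma prox_lipschitz:
  assumes m: "0 < m"
  shows "m * norm (prox m b' - prox m b) \<le> norm (b' - b)"
proof -
  let ?d = "prox m b' - prox m b"
  have "0 \<le> ((b' - b) - m *\<^sub>R ?d) \<bullet> ?d"
    using prox_monotone[of m m b' b] m by (simp add: algebra_simps)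
  then have "m * (norm ?d * norm ?d) \<le> (b' - b) \<bullet> ?d"
    by (simp add: inner_diff_left power2_norm_eq_inner[symmetric] power2_eq_square)
  also have "\<dots> \<le> norm (b' - b) * norm ?d" by (rule norm_cauchy_schwarz)
  finally have "norm ?d * (m * norm ?d) \<le> norm ?d * norm (b' - b)" by (simp add: mult_ac)
  then show ?thesis by (cases "?d = 0") (auto simp: mult_le_cancel_left)
qed

lemma continuous_prox:
  assumes m: "0 < m"
  shows "continuous_on UNIV (prox m)"
proof -
  have "(1 / m)-lipschitz_on UNIV (prox m)"
  proof (rule lipschitz_onI)
    fix x y show "dist (prox m x) (prox m y) \<le> 1 / m * dist x y"
      using prox_lipschitz[OF m, of x y] m by (simp add: dist_norm field_simps)
  qed (use m in auto)
  then show ?thesis by (rule lipschitz_on_continuous_on)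
qed

text \<open>
  Adding a quadratic centred at \<open>x\<close> moves the minimiser from \<open>a\<close> to \<open>a'\<close>, towards \<open>x\<close>: monotonicity
  gives \<open>(x - a') \<bullet> (a' - a) \<ge> 0\<close>, so the angle at \<open>a'\<close> in the triangle \<open>x\<close>, \<open>a'\<close>, \<open>a\<close> is at least
  a right angle and both sides at \<open>a'\<close> are at most as long as the side opposite to it.
\<close>

lemma prox_drift:
  fixes b x :: 'a
  assumes m: "0 < m" and n: "0 \<le> n"
  defines "a \<equiv> prox m b" and "a' \<equiv> prox (m + n) (b + n *\<^sub>R x)"
  shows "norm (x - a') \<le> norm (x - a)" "norm (a - a') \<le> norm (x - a)"
proof -
  have nn: "0 \<le> (x - a') \<bullet> (a' - a)"
  proof (cases "n = 0")
    case True
    then show ?thesis by (simp add: a_def a'_def)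
  next
    case False
    have eq: "(b + n *\<^sub>R x - (m + n) *\<^sub>R u) - (b - m *\<^sub>R v)
        = n *\<^sub>R (x - u) - m *\<^sub>R (u - v)" for u v
      by (simp add: algebra_simps)
    have "0 \<le> ((b + n *\<^sub>R x - (m + n) *\<^sub>R a') - (b - m *\<^sub>R a)) \<bullet> (a' - a)"
      using m n unfolding a_def a'_def by (intro prox_monotone) auto
    then have "m * ((a' - a) \<bullet> (a' - a)) \<le> n * ((x - a') \<bullet> (a' - a))"
      unfolding eq by (simp only: inner_diff_left[of "n *\<^sub>R (x - a')"] inner_scaleR_left diff_ge_0_iff_ge)
    moreover have "0 \<le> m * ((a' - a) \<bullet> (a' - a))" using m by simp
    ultimately have "0 \<le> n * ((x - a') \<bullet> (a' - a))" by linarith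
    with False n show ?thesis by (simp add: zero_le_mult_iff)
  qed
  have "(norm (x - a))\<^sup>2 = (norm (x - a'))\<^sup>2 + (norm (a - a'))\<^sup>2 + 2 * ((x - a') \<bullet> (a' - a))"
    using norm_add_sq[of "x - a'" "a' - a"] by (simp add: norm_minus_commute)
  with nn have "(norm (x - a'))\<^sup>2 \<le> (norm (x - a))\<^sup>2 \<and> (norm (a - a'))\<^sup>2 \<le> (norm (x - a))\<^sup>2"
    using zero_le_power2[of "norm (x - a')"] zero_le_power2[of "norm (a - a')"] by linarith
  then show "norm (x - a') \<le> norm (x - a)" "norm (a - a') \<le> norm (x - a)"
    by (auto intro: power2_le_imp_le)
qed

text \<open>
  The residual \<open>b - m *\<^sub>R prox m b\<close> is what becomes the gradient of the Moreau envelope once the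
  total weight has reached the reciprocal of the envelope parameter. Adding a quadratic centred at an approximate minimiser \<open>x\<close> increases
  it only by the new total weight times the error of \<open>x\<close>.
\<close>

lemma residual_growth:
  fixes b x :: 'a
  assumes m: "0 < m" and n: "0 \<le> n"
  defines "b' \<equiv> b + n *\<^sub>R x"
  shows "norm (b' - (m + n) *\<^sub>R prox (m + n) b')
    \<le> norm (b - m *\<^sub>R prox m b) + (m + n) * norm (x - prox m b)"
proof -
  let ?a = "prox m b" and ?a' = "prox (m + n) b'"
  note drift = prox_drift[OF m n, where x = x and b = b, folded b'_def]
  have "b + n *\<^sub>R x - (m + n) *\<^sub>R u = (b - m *\<^sub>R v) + (m *\<^sub>R (v - u) + n *\<^sub>R (x - u))" for u v
    by (simp add: algebra_simps)
  then have "b' - (m + n) *\<^sub>R ?a' = (b - m *\<^sub>R ?a) + (m *\<^sub>R (?a - ?a') + n *\<^sub>R (x - ?a'))"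
    unfolding b'_def .
  then have "norm (b' - (m + n) *\<^sub>R ?a')
      \<le> norm (b - m *\<^sub>R ?a) + (norm (m *\<^sub>R (?a - ?a')) + norm (n *\<^sub>R (x - ?a')))"
    by (simp add: norm_triangle_le norm_triangle_ineq)
  also have "norm (m *\<^sub>R (?a - ?a')) \<le> m * norm (x - ?a)"
    using m drift(2) by simp
  also have "norm (n *\<^sub>R (x - ?a')) \<le> n * norm (x - ?a)"
    using n drift(1) by (simp add: mult_left_mono)
  finally show ?thesis by (simp add: algebra_simps)
qed

section \<open>The gradient of the Moreau envelope\<close>

lemma moreau_envelope_eq:
  assumes r: "0 < r"
  defines "p \<equiv> \<lambda>z. prox (2 * r) ((2 * r) *\<^sub>R z)"
  shows "moreau_envelope (1 / (2 * r)) (restrict_to X g) z = ereal (g (p z) + r * (norm (p z - z))\<^sup>2)"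
proof -
  have p: "p z \<in> X" using r by (auto simp: p_def prox_in)
  have min: "g (p z) + r * (norm (p z - z))\<^sup>2 \<le> g y + r * (norm (y - z))\<^sup>2" if "y \<in> X" for y
  proof -
    have eq: "(norm (y - z))\<^sup>2 = (norm (p z - z))\<^sup>2 - 2 * ((z - p z) \<bullet> (y - p z)) + (norm (y - p z))\<^sup>2"
      using norm_diff_sq[of "y - p z" "z - p z"]
      by (simp add: inner_commute norm_minus_commute)
    moreover have "g (p z) + 2 * r * ((z - p z) \<bullet> (y - p z)) \<le> g y"
      using prox_subgradient[of "2 * r" y "(2 * r) *\<^sub>R z"] r that
      by (simp add: p_def scaleR_diff_right[symmetric])
    moreover have "0 \<le> r * (norm (y - p z))\<^sup>2" using r by simp
    ultimately show ?thesis by (simp add: eq algebra_simps)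
  qed
  show ?thesis unfolding moreau_envelope_def
  proof (rule antisym)
    show "(INF y. restrict_to X g y + ereal (1 / (2 * (1 / (2 * r))) * (norm (y - z))\<^sup>2))
        \<le> ereal (g (p z) + r * (norm (p z - z))\<^sup>2)"
      using p by (intro INF_lower2[of "p z"]) (auto simp: restrict_to_def)
    show "ereal (g (p z) + r * (norm (p z - z))\<^sup>2)
        \<le> (INF y. restrict_to X g y + ereal (1 / (2 * (1 / (2 * r))) * (norm (y - z))\<^sup>2))"
      using min by (intro INF_greatest) (auto simp: restrict_to_def)
  qed
qed

text \<open>
  Testing the infimum that defines the envelope at \<open>z'\<close> with the proximal point of \<open>z\<close> bounds the
  envelope from above by its linearisation at \<open>z\<close> plus \<open>r * (norm (z' - z))\<^sup>2\<close>. Exchanging the two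
  points gives a lower bound with the candidate gradient taken at \<open>z'\<close>, and monotonicity of the
  candidate gradient, which holds because \<open>prox\<close> is nonexpansive in the centre, replaces it by the
  one at \<open>z\<close>.
\<close>

lemma grad_moreau_envelope:
  assumes r: "0 < r"
  shows "grad (\<lambda>x. real_of_ereal (moreau_envelope (1 / (2 * r)) (restrict_to X g) x)) z
    = (2 * r) *\<^sub>R z - (2 * r) *\<^sub>R prox (2 * r) ((2 * r) *\<^sub>R z)"
proof -
  define p where "p z = prox (2 * r) ((2 * r) *\<^sub>R z)" for z
  define e where "e z = g (p z) + r * (norm (p z - z))\<^sup>2" for z
  define v where "v z = (2 * r) *\<^sub>R (z - p z)" for z
  have p: "p z \<in> X" for z using r by (auto simp: p_def prox_in)
  have upper: "e z' - e z \<le> v z \<bullet> (z' - z) + r * (norm (z' - z))\<^sup>2" for z z'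
  proof -
    have "g (p z') + 2 * r * ((z' - p z') \<bullet> (p z - p z')) \<le> g (p z)"
      using prox_subgradient[of "2 * r" "p z" "(2 * r) *\<^sub>R z'"] r p
      by (simp add: p_def scaleR_diff_right[symmetric])
    moreover have eq1: "(norm (p z - z'))\<^sup>2
        = (norm (p z' - z'))\<^sup>2 - 2 * ((z' - p z') \<bullet> (p z - p z')) + (norm (p z - p z'))\<^sup>2"
      using norm_diff_sq[of "p z - p z'" "z' - p z'"]
      by (simp add: inner_commute norm_minus_commute)
    moreover have "0 \<le> r * (norm (p z - p z'))\<^sup>2" using r by simp
    ultimately have "e z' \<le> g (p z) + r * (norm (p z - z'))\<^sup>2"
      by (simp add: e_def eq1 algebra_simps)
    moreover have eq2: "(norm (p z - z'))\<^sup>2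
        = (norm (p z - z))\<^sup>2 + 2 * ((z - p z) \<bullet> (z' - z)) + (norm (z' - z))\<^sup>2"
      using norm_add_sq[of "z - p z" "z' - z"]
      by (simp add: norm_minus_commute)
    ultimately show ?thesis
      by (simp add: e_def v_def eq2 algebra_simps)
  qed
  have mono: "0 \<le> (v z' - v z) \<bullet> (z' - z)" for z z'
  proof -
    have "2 * r * norm (p z' - p z) \<le> norm ((2 * r) *\<^sub>R (z' - z))"
      using prox_lipschitz[of "2 * r" "(2 * r) *\<^sub>R z'" "(2 * r) *\<^sub>R z"] r
      by (simp add: p_def scaleR_diff_right)
    then have "norm (p z' - p z) \<le> norm (z' - z)" using r by simp
    then have "norm (p z' - p z) * norm (z' - z) \<le> norm (z' - z) * norm (z' - z)"
      by (intro mult_right_mono) auto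
    with norm_cauchy_schwarz[of "p z' - p z" "z' - z"]
    have "0 \<le> ((z' - z) - (p z' - p z)) \<bullet> (z' - z)"
      by (simp add: inner_diff_left[of "z' - z"] power2_norm_eq_inner[symmetric] power2_eq_square)
    moreover have "v z' - v z = (2 * r) *\<^sub>R ((z' - z) - (p z' - p z))"
      by (simp add: v_def algebra_simps)
    ultimately show ?thesis using r by simp
  qed
  have "GDERIV e z :> v z" unfolding gderiv_def has_derivative_at
  proof (intro conjI)
    show "bounded_linear (\<lambda>h. h \<bullet> v z)" by (rule bounded_linear_inner_left)
    show "(\<lambda>h. norm (e (z + h) - e z - h \<bullet> v z) / norm h) \<midarrow>0\<rightarrow> 0"
    proof (rule Lim_null_comparison)
      show "((\<lambda>h. r * norm h) \<longlongrightarrow> 0) (at (0::'a))"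
        by (intro tendsto_eq_intros) auto
      have "norm (norm (e (z + h) - e z - h \<bullet> v z) / norm h) \<le> r * norm h" for h
      proof -
        have "e (z + h) - e z - h \<bullet> v z \<le> r * (norm h)\<^sup>2"
          using upper[of "z + h" z] by (simp add: inner_commute)
        moreover have "- (r * (norm h)\<^sup>2) \<le> e (z + h) - e z - h \<bullet> v z"
          using upper[of z "z + h"] mono[of "z + h" z] by (simp add: inner_commute inner_simps)
        ultimately show ?thesis by (cases "h = 0") (auto simp: divide_simps power2_eq_square abs_le_iff)
      qed
      then show "\<forall>\<^sub>F h in at 0. norm (norm (e (z + h) - e z - h \<bullet> v z) / norm h) \<le> r * norm h"
        by simp
    qed
  qed
  moreover have "w = v z" if "GDERIV e z :> w" for w
  proof -
    have "(\<lambda>h. h \<bullet> w) = (\<lambda>h. h \<bullet> v z)"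
      using that calculation unfolding gderiv_def by (rule has_derivative_unique)
    then have "h \<bullet> w = h \<bullet> v z" for h by (rule fun_cong)
    then show ?thesis using inner_eq_zero_iff[of "w - v z"] by (simp add: inner_simps)
  qed
  ultimately have "grad e z = v z" unfolding grad_def by blast
  moreover have "(\<lambda>x. real_of_ereal (moreau_envelope (1 / (2 * r)) (restrict_to X g) x)) = e"
    using moreau_envelope_eq[OF r] by (simp add: e_def p_def fun_eq_iff)
  ultimately show ?thesis by (simp add: v_def p_def scaleR_diff_right)
qed

section \<open>One projected step\<close>

lemma projected_step:
  assumes "a \<in> X"
  shows "2 * (s * (h \<bullet> (x - a)))
    \<le> s\<^sup>2 * (norm h)\<^sup>2 + (norm (x - a))\<^sup>2 - (norm (closest_point X (x - s *\<^sub>R h) - a))\<^sup>2"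
proof -
  have "closest_point X a = a" using assms by (rule closest_point_self)
  then have "norm (closest_point X (x - s *\<^sub>R h) - a) \<le> norm (x - s *\<^sub>R h - a)"
    using closest_point_lipschitz[OF X(3,2,1), of "x - s *\<^sub>R h" a] by (simp add: dist_norm)
  then have "(norm (closest_point X (x - s *\<^sub>R h) - a))\<^sup>2 \<le> (norm (x - s *\<^sub>R h - a))\<^sup>2"
    by (simp add: power_mono)
  also have "\<dots> = (norm (x - a))\<^sup>2 - 2 * (s * (h \<bullet> (x - a))) + s\<^sup>2 * (norm h)\<^sup>2"
    using norm_diff_sq[of "x - a" "s *\<^sub>R h"]
    by (simp add: algebra_simps inner_commute power_mult_distrib)
  finally show ?thesis by simp
qed

lemma closest_point_in: "closest_point X x \<in> X"
  using X by (simp add: closest_point_in_set)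

end

section \<open>Independence of fresh samples from the past\<close>

locale stochastic_oracle = constrained_problem X g D + Q: prob_space Q
  for X :: "'a::euclidean_space set" and g and D and Q :: "'q measure" +
  fixes U :: "'a set" and M :: "'w measure" and G :: "'a \<Rightarrow> 'w \<Rightarrow> 'a"
    and \<xi> :: "nat \<Rightarrow> 'q \<Rightarrow> 'w" and L :: real
  assumes M: "prob_space M"
    and indep: "Q.indep_vars (\<lambda>_. M) \<xi> UNIV" and distr_xi: "\<And>n. distr Q M (\<xi> n) = M"
    and X_subset: "X \<subseteq> U"
    and G_measurable: "(\<lambda>(x, v). G x v) \<in> borel_measurable (restrict_space borel U \<Otimes>\<^sub>M M)"
    and G_integrable: "\<And>x. x \<in> U \<Longrightarrow> integrable M (G x)"
    and G_subgradient: "\<And>x. x \<in> U \<Longrightarrow> (\<integral>v. G x v \<partial>M) \<in> subdifferential g x"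
    and G_moment_integrable: "\<And>x. x \<in> X \<Longrightarrow> integrable M (\<lambda>v. (norm (G x v))\<^sup>2)"
    and G_moment: "\<And>x. x \<in> X \<Longrightarrow> (\<integral>v. (norm (G x v))\<^sup>2 \<partial>M) \<le> L\<^sup>2"
begin

sublocale M: prob_space M by (rule M)

text \<open>
  The \<open>\<sigma>\<close>-algebra generated by the samples with indices below \<open>n\<close>.
\<close>

definition past :: "nat \<Rightarrow> 'q measure" where
  "past n = vimage_algebra (space Q) (\<lambda>\<omega>. \<lambda>i\<in>{..<n}. \<xi> i \<omega>) (PiM {..<n} (\<lambda>_. M))"

lemma xi_measurable [measurable]: "\<xi> n \<in> Q \<rightarrow>\<^sub>M M"
  using indep by (auto simp: Q.indep_vars_def)

lemma space_past [simp]: "space (past n) = space Q"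
  by (simp add: past_def)

lemma xi_measurable_past: "i < n \<Longrightarrow> \<xi> i \<in> past n \<rightarrow>\<^sub>M M"
proof -
  assume i: "i < n"
  have "(\<lambda>\<omega>. \<lambda>i\<in>{..<n}. \<xi> i \<omega>) \<in> past n \<rightarrow>\<^sub>M PiM {..<n} (\<lambda>_. M)"
    unfolding past_def using measurable_space[OF xi_measurable]
    by (intro measurable_vimage_algebra1) (auto simp: space_PiM)
  from measurable_compose[OF this measurable_component_singleton[of i]] i
  show ?thesis by simp
qed

lemma past_least:
  assumes "\<And>i. i < n \<Longrightarrow> \<xi> i \<in> N \<rightarrow>\<^sub>M M" and space: "space N = space Q"
    and f: "f \<in> past n \<rightarrow>\<^sub>M S"
  shows "f \<in> N \<rightarrow>\<^sub>M S"
proof -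
  have "(\<lambda>\<omega>. \<lambda>i\<in>{..<n}. \<xi> i \<omega>) \<in> N \<rightarrow>\<^sub>M PiM {..<n} (\<lambda>_. M)"
    using assms(1) by (intro measurable_restrict) simp
  then have sub: "sets (past n) \<subseteq> sets N"
    unfolding past_def by (rule sets_image_in_sets[OF space])
  show ?thesis
  proof (rule measurableI)
    show "f x \<in> space S" if "x \<in> space N" for x
      using measurable_space[OF f, of x] that space by simp
    show "f -` A \<inter> space N \<in> sets N" if "A \<in> sets S" for A
      using measurable_sets[OF f that] space by (simp add: subsetD[OF sub])
  qed
qed

lemma measurable_past_imp: "f \<in> past n \<rightarrow>\<^sub>M S \<Longrightarrow> f \<in> Q \<rightarrow>\<^sub>M S"
  using past_least[OF xi_measurable refl] .

lemma measurable_past_mono: "f \<in> past n \<rightarrow>\<^sub>M S \<Longrightarrow> n \<le> k \<Longrightarrow> f \<in> past k \<rightarrow>\<^sub>M S"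
  by (rule past_least[OF xi_measurable_past space_past]) auto

text \<open>
  The past enters as a \<open>\<sigma>\<close>-algebra, because the quantities computed from earlier samples take values
  in a different type than the samples. The sample \<open>\<xi> n\<close> generates the same events as the family
  with the one index \<open>n\<close>, so this is the independence of two disjoint families of samples.
\<close>

lemma past_fresh_prob:
  assumes A: "A \<in> sets (past n)" and B: "B \<in> sets M"
  shows "Q.prob (A \<inter> (\<xi> n -` B \<inter> space Q)) = Q.prob A * Q.prob (\<xi> n -` B \<inter> space Q)"
proof -
  let ?R = "\<lambda>I \<omega>. \<lambda>i\<in>I. \<xi> i \<omega>"
  have "Q.indep_var (PiM {..<n} (\<lambda>_. M)) (?R {..<n}) (PiM {n} (\<lambda>_. M)) (?R {n})"
    by (rule Q.indep_var_restrict[OF indep]) auto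
  then have "Q.indep_set (sets (past n)) (sigma_sets (space Q) {?R {n} -` C \<inter> space Q |C. C \<in> sets (PiM {n} (\<lambda>_. M))})"
    unfolding Q.indep_var_eq past_def sets_vimage_algebra by blast
  moreover have "\<xi> n -` B \<inter> space Q \<in> sigma_sets (space Q) {?R {n} -` C \<inter> space Q |C. C \<in> sets (PiM {n} (\<lambda>_. M))}"
  proof -
    let ?C = "(\<lambda>x. x n) -` B \<inter> space (PiM {n} (\<lambda>_. M))"
    have "(\<lambda>x. x n) \<in> PiM {n} (\<lambda>_. M) \<rightarrow>\<^sub>M M" by (rule measurable_component_singleton) simp
    from measurable_sets[OF this B] have "?C \<in> sets (PiM {n} (\<lambda>_. M))" .
    moreover have "\<xi> n -` B \<inter> space Q = ?R {n} -` ?C \<inter> space Q"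
      using measurable_space[OF xi_measurable[of n]] by (auto simp: space_PiM)
    ultimately show ?thesis by blast
  qed
  ultimately show ?thesis using A unfolding Q.indep_sets2_eq by blast
qed

text \<open>
  By this identity, averaging over a fresh sample may be carried out with everything that was
  computed from earlier samples held fixed.
\<close>

lemma fresh_distr:
  assumes Z: "Z \<in> past n \<rightarrow>\<^sub>M S"
  shows "distr Q S Z \<Otimes>\<^sub>M M = distr Q (S \<Otimes>\<^sub>M M) (\<lambda>\<omega>. (Z \<omega>, \<xi> n \<omega>))"
proof (rule pair_measure_eqI)
  note Z' [measurable] = measurable_past_imp[OF Z]
  interpret N: prob_space "distr Q S Z" by (rule Q.prob_space_distr) simp
  show "sigma_finite_measure (distr Q S Z)" "sigma_finite_measure M" by unfold_locales
  show "sets (distr Q S Z \<Otimes>\<^sub>M M) = sets (distr Q (S \<Otimes>\<^sub>M M) (\<lambda>\<omega>. (Z \<omega>, \<xi> n \<omega>)))" by simp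
  fix A B assume A: "A \<in> sets (distr Q S Z)" and B: "B \<in> sets M"
  from A have A': "A \<in> sets S" by simp
  have "emeasure M B = emeasure (distr Q M (\<xi> n)) B" by (simp add: distr_xi)
  also have "\<dots> = ennreal (Q.prob (\<xi> n -` B \<inter> space Q))"
    using B by (simp add: emeasure_distr Q.emeasure_eq_measure)
  finally have MB: "emeasure M B = ennreal (Q.prob (\<xi> n -` B \<inter> space Q))" .
  have "emeasure (distr Q (S \<Otimes>\<^sub>M M) (\<lambda>\<omega>. (Z \<omega>, \<xi> n \<omega>))) (A \<times> B)
      = emeasure Q ((\<lambda>\<omega>. (Z \<omega>, \<xi> n \<omega>)) -` (A \<times> B) \<inter> space Q)"
    using A' B by (intro emeasure_distr) auto
  also have "(\<lambda>\<omega>. (Z \<omega>, \<xi> n \<omega>)) -` (A \<times> B) \<inter> space Q = (Z -` A \<inter> space Q) \<inter> (\<xi> n -` B \<inter> space Q)"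
    by auto
  finally show "emeasure (distr Q S Z) A * emeasure M B
      = emeasure (distr Q (S \<Otimes>\<^sub>M M) (\<lambda>\<omega>. (Z \<omega>, \<xi> n \<omega>))) (A \<times> B)"
    using measurable_sets[OF Z A'] A' B
    by (simp add: MB emeasure_distr[OF Z'] Q.emeasure_eq_measure past_fresh_prob ennreal_mult'')
qed

lemma fresh_nn_integral:
  assumes Z: "Z \<in> past n \<rightarrow>\<^sub>M S" and h: "h \<in> borel_measurable (S \<Otimes>\<^sub>M M)"
  shows "(\<integral>\<^sup>+\<omega>. h (Z \<omega>, \<xi> n \<omega>) \<partial>Q) = (\<integral>\<^sup>+\<omega>. (\<integral>\<^sup>+v. h (Z \<omega>, v) \<partial>M) \<partial>Q)"
proof -
  note [measurable] = measurable_past_imp[OF Z] h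
  have "(\<integral>\<^sup>+\<omega>. h (Z \<omega>, \<xi> n \<omega>) \<partial>Q) = (\<integral>\<^sup>+z. h z \<partial>distr Q (S \<Otimes>\<^sub>M M) (\<lambda>\<omega>. (Z \<omega>, \<xi> n \<omega>)))"
    by (subst nn_integral_distr) auto
  also have "\<dots> = (\<integral>\<^sup>+z. (\<integral>\<^sup>+v. h (z, v) \<partial>M) \<partial>distr Q S Z)"
    unfolding fresh_distr[OF Z, symmetric] using h by (subst M.nn_integral_fst) auto
  also have "\<dots> = (\<integral>\<^sup>+\<omega>. (\<integral>\<^sup>+v. h (Z \<omega>, v) \<partial>M) \<partial>Q)"
    by (subst nn_integral_distr) auto
  finally show ?thesis .
qed

lemma fresh_integral:
  fixes h :: "_ \<Rightarrow> real"
  assumes Z: "Z \<in> past n \<rightarrow>\<^sub>M S" and h: "h \<in> borel_measurable (S \<Otimes>\<^sub>M M)"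
    and int: "integrable Q (\<lambda>\<omega>. h (Z \<omega>, \<xi> n \<omega>))"
  shows "integrable Q (\<lambda>\<omega>. \<integral>v. h (Z \<omega>, v) \<partial>M)" (is ?int)
    and "(\<integral>\<omega>. h (Z \<omega>, \<xi> n \<omega>) \<partial>Q) = (\<integral>\<omega>. (\<integral>v. h (Z \<omega>, v) \<partial>M) \<partial>Q)" (is ?eq)
proof -
  note [measurable] = measurable_past_imp[OF Z] h
  interpret N: prob_space "distr Q S Z" by (rule Q.prob_space_distr) simp
  interpret P: pair_sigma_finite "distr Q S Z" M ..
  have "integrable (distr Q (S \<Otimes>\<^sub>M M) (\<lambda>\<omega>. (Z \<omega>, \<xi> n \<omega>))) h"
    using int by (subst integrable_distr_eq) auto
  then have hP: "integrable (distr Q S Z \<Otimes>\<^sub>M M) h" unfolding fresh_distr[OF Z, symmetric] .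
  from P.integrable_fst'[OF hP] show ?int
    by (subst (asm) integrable_distr_eq) auto
  have "(\<integral>\<omega>. h (Z \<omega>, \<xi> n \<omega>) \<partial>Q) = (\<integral>z. h z \<partial>distr Q (S \<Otimes>\<^sub>M M) (\<lambda>\<omega>. (Z \<omega>, \<xi> n \<omega>)))"
    by (subst integral_distr) auto
  also have "\<dots> = (\<integral>z. (\<integral>v. h (z, v) \<partial>M) \<partial>distr Q S Z)"
    unfolding fresh_distr[OF Z, symmetric] using P.integral_fst'[OF hP] by simp
  also have "\<dots> = (\<integral>\<omega>. (\<integral>v. h (Z \<omega>, v) \<partial>M) \<partial>Q)"
    by (subst integral_distr) auto
  finally show ?eq .
qed

lemma measurable_to_U:
  assumes "u \<in> N \<rightarrow>\<^sub>M borel" "\<And>\<omega>. u \<omega> \<in> X"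
  shows "u \<in> N \<rightarrow>\<^sub>M restrict_space borel U"
  using assms X_subset by (intro measurable_restrict_space2) auto

lemma oracle_measurable_past:
  assumes u: "u \<in> past n \<rightarrow>\<^sub>M borel" "\<And>\<omega>. u \<omega> \<in> X"
  shows "(\<lambda>\<omega>. G (u \<omega>) (\<xi> n \<omega>)) \<in> past (Suc n) \<rightarrow>\<^sub>M borel"
proof -
  have "(\<lambda>\<omega>. (u \<omega>, \<xi> n \<omega>)) \<in> past (Suc n) \<rightarrow>\<^sub>M restrict_space borel U \<Otimes>\<^sub>M M"
    using measurable_past_mono[OF measurable_to_U[OF u], of "Suc n"] xi_measurable_past[of n "Suc n"]
    by (intro measurable_Pair) auto
  from measurable_compose[OF this G_measurable] show ?thesis by simp
qed

text \<open>
  The hypotheses on the oracle are about a deterministic query point. The next two lemmas transfer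
  them to a query point that depends on earlier samples, with the comparison point \<open>y\<close> of the second
  lemma also depending on them; this is needed because the minimisers that the inner loops
  approximate are random.
\<close>

lemma oracle_second_moment:
  assumes u: "u \<in> past n \<rightarrow>\<^sub>M borel" "\<And>\<omega>. u \<omega> \<in> X"
  shows "integrable Q (\<lambda>\<omega>. (norm (G (u \<omega>) (\<xi> n \<omega>)))\<^sup>2)"
    and "(\<integral>\<omega>. (norm (G (u \<omega>) (\<xi> n \<omega>)))\<^sup>2 \<partial>Q) \<le> L\<^sup>2"
proof -
  note [measurable] = measurable_past_imp[OF oracle_measurable_past[OF u]] G_measurable
  have "(\<integral>\<^sup>+\<omega>. ennreal ((norm (G (u \<omega>) (\<xi> n \<omega>)))\<^sup>2) \<partial>Q)
      = (\<integral>\<^sup>+\<omega>. (\<integral>\<^sup>+v. ennreal ((norm (G (u \<omega>) v))\<^sup>2) \<partial>M) \<partial>Q)"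
    using fresh_nn_integral[OF measurable_to_U[OF u], of "\<lambda>(x, v). ennreal ((norm (G x v))\<^sup>2)"]
    by (simp add: case_prod_beta')
  also have "\<dots> \<le> (\<integral>\<^sup>+\<omega>. ennreal (L\<^sup>2) \<partial>Q)"
    using u(2) G_moment by (intro nn_integral_mono)
      (simp add: nn_integral_eq_integral[OF G_moment_integrable] ennreal_leI)
  finally have le: "(\<integral>\<^sup>+\<omega>. ennreal ((norm (G (u \<omega>) (\<xi> n \<omega>)))\<^sup>2) \<partial>Q) \<le> ennreal (L\<^sup>2)"
    by (simp add: Q.emeasure_space_1)
  show "integrable Q (\<lambda>\<omega>. (norm (G (u \<omega>) (\<xi> n \<omega>)))\<^sup>2)"
    using le by (intro integrableI_nonneg) (auto simp: le_less_trans)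
  then show "(\<integral>\<omega>. (norm (G (u \<omega>) (\<xi> n \<omega>)))\<^sup>2 \<partial>Q) \<le> L\<^sup>2"
    using le by (simp add: nn_integral_eq_integral)
qed

lemma oracle_subgradient:
  assumes u: "u \<in> past n \<rightarrow>\<^sub>M borel" "\<And>\<omega>. u \<omega> \<in> X"
    and y: "y \<in> past n \<rightarrow>\<^sub>M borel" "\<And>\<omega>. y \<omega> \<in> X"
  shows "integrable Q (\<lambda>\<omega>. G (u \<omega>) (\<xi> n \<omega>) \<bullet> (u \<omega> - y \<omega>))"
    and "integrable Q (\<lambda>\<omega>. g (u \<omega>) - g (y \<omega>))"
    and "(\<integral>\<omega>. g (u \<omega>) - g (y \<omega>) \<partial>Q) \<le> (\<integral>\<omega>. G (u \<omega>) (\<xi> n \<omega>) \<bullet> (u \<omega> - y \<omega>) \<partial>Q)"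
proof -
  note [measurable] = measurable_past_imp[OF u(1)] measurable_past_imp[OF y(1)]
    measurable_past_imp[OF oracle_measurable_past[OF u]] G_measurable
    borel_measurable_continuous_onI[OF g(2)]
  have "compact (g ` X)"
    using X g by (intro compact_continuous_image)
      (auto simp: compact_eq_bounded_closed intro: continuous_on_subset)
  then obtain K where "\<forall>x\<in>X. \<bar>g x\<bar> \<le> K"
    by (auto dest!: compact_imp_bounded simp: bounded_iff)
  then have K: "\<And>x. x \<in> X \<Longrightarrow> \<bar>g x\<bar> \<le> K" by blast
  have "integrable Q (\<lambda>\<omega>. g (u \<omega>))" "integrable Q (\<lambda>\<omega>. g (y \<omega>))"
    using K u y by (auto intro!: Q.integrable_const_bound[of _ K] AE_I2)
  then show int_g: "integrable Q (\<lambda>\<omega>. g (u \<omega>) - g (y \<omega>))" by simp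
  have bound: "\<bar>v \<bullet> (u \<omega> - y \<omega>)\<bar> \<le> D * (1 + (norm v)\<^sup>2)" for v \<omega>
  proof -
    have "\<bar>v \<bullet> (u \<omega> - y \<omega>)\<bar> \<le> norm v * norm (u \<omega> - y \<omega>)" by (rule Cauchy_Schwarz_ineq2)
    also have "\<dots> \<le> (1 + (norm v)\<^sup>2) * D"
    proof (rule mult_mono)
      show "norm v \<le> 1 + (norm v)\<^sup>2"
        using zero_le_power2[of "norm v - 1"] norm_ge_zero[of v] by (simp add: power2_diff del: norm_ge_zero)
    qed (use dist_le[OF u(2) y(2)] in simp_all)
    finally show ?thesis by (simp add: mult.commute)
  qed
  show int: "integrable Q (\<lambda>\<omega>. G (u \<omega>) (\<xi> n \<omega>) \<bullet> (u \<omega> - y \<omega>))"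
  proof (rule Bochner_Integration.integrable_bound)
    show "integrable Q (\<lambda>\<omega>. D * (1 + (norm (G (u \<omega>) (\<xi> n \<omega>)))\<^sup>2))"
      using oracle_second_moment(1)[OF u] by simp
    show "AE \<omega> in Q. norm (G (u \<omega>) (\<xi> n \<omega>) \<bullet> (u \<omega> - y \<omega>))
        \<le> norm (D * (1 + (norm (G (u \<omega>) (\<xi> n \<omega>)))\<^sup>2))"
      unfolding real_norm_def by (intro AE_I2 order_trans[OF bound abs_ge_self])
  qed simp
  let ?S = "restrict_space borel U \<Otimes>\<^sub>M (borel :: 'a measure)"
  have Z: "(\<lambda>\<omega>. (u \<omega>, y \<omega>)) \<in> past n \<rightarrow>\<^sub>M ?S"
    using measurable_to_U[OF u] y by (intro measurable_Pair) auto
  have id_meas: "(\<lambda>x. x) \<in> restrict_space borel U \<rightarrow>\<^sub>M (borel :: 'a measure)"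
    by (rule measurable_restrict_space1) simp
  have h: "(\<lambda>((x, y), v). G x v \<bullet> (x - y)) \<in> borel_measurable (?S \<Otimes>\<^sub>M M)"
  proof -
    have G': "(\<lambda>z. G (fst (fst z)) (snd z)) \<in> borel_measurable (?S \<Otimes>\<^sub>M M)"
      using measurable_compose[OF _ G_measurable, of "\<lambda>z. (fst (fst z), snd z)" "?S \<Otimes>\<^sub>M M"] by simp
    have "(\<lambda>z. fst (fst z)) \<in> ?S \<Otimes>\<^sub>M M \<rightarrow>\<^sub>M (borel :: 'a measure)"
      by (rule measurable_compose[OF _ id_meas]) simp
    with G' show ?thesis by (auto simp: case_prod_beta' intro!: borel_measurable_inner borel_measurable_diff)
  qed
  note fresh = fresh_integral[OF Z h, simplified, OF int]
  have "(\<integral>\<omega>. g (u \<omega>) - g (y \<omega>) \<partial>Q) \<le> (\<integral>\<omega>. (\<integral>v. G (u \<omega>) v \<bullet> (u \<omega> - y \<omega>) \<partial>M) \<partial>Q)"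
  proof (rule integral_mono[OF int_g fresh(1)])
    fix \<omega>
    have U: "u \<omega> \<in> U" using u(2) X_subset by blast
    have "g (u \<omega>) + (\<integral>v. G (u \<omega>) v \<partial>M) \<bullet> (y \<omega> - u \<omega>) \<le> g (y \<omega>)"
      using G_subgradient[OF U] by (auto simp: subdifferential_def)
    moreover have "(\<integral>v. G (u \<omega>) v \<bullet> (u \<omega> - y \<omega>) \<partial>M) = (\<integral>v. G (u \<omega>) v \<partial>M) \<bullet> (u \<omega> - y \<omega>)"
      using G_integrable[OF U] by simp
    ultimately show "g (u \<omega>) - g (y \<omega>) \<le> (\<integral>v. G (u \<omega>) v \<bullet> (u \<omega> - y \<omega>) \<partial>M)"
      by (simp add: inner_diff_right)
  qed
  then show "(\<integral>\<omega>. g (u \<omega>) - g (y \<omega>) \<partial>Q) \<le> (\<integral>\<omega>. G (u \<omega>) (\<xi> n \<omega>) \<bullet> (u \<omega> - y \<omega>) \<partial>Q)"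
    by (simp add: fresh(2))
qed

end

section \<open>One run of the projected subgradient method\<close>

lemma snd_pssm_iter: "snd (pssm_iter X x0 m H w (p, n) t) = (p + t, n + t)"
  by (induction t) (auto split: prod.splits)

lemma fst_pssm_iter_Suc:
  "fst (pssm_iter X x0 m H w (p, n) (Suc t)) =
    (let x = fst (pssm_iter X x0 m H w (p, n) t)
     in closest_point X (x - (2 / (m * (real t + 1))) *\<^sub>R H x (w (n + t))))"
  using snd_pssm_iter[of X x0 m H w p n t] by (auto split: prod.splits simp: Let_def)

lemma sum_of_ranks: "(\<Sum>t<T. real t + 1) = real T * (real T + 1) / 2"
  by (induction T) (auto simp: field_simps)

lemma pssm_weights: "0 < T \<Longrightarrow> (\<Sum>t<T. 2 / (real T * (real T + 1)) * (real t + 1)) = 1"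
  by (simp only: sum_distrib_left[symmetric] sum_of_ranks) simp

lemma fst_pssm_sc:
  "fst (pssm_sc X x0 m H T w c)
    = (\<Sum>t<T. (2 / (real T * (real T + 1)) * (real t + 1)) *\<^sub>R fst (pssm_iter X x0 m H w c t))"
  by (simp add: pssm_sc_def scaleR_sum_right)

context constrained_problem
begin

lemma pssm_iter_in: "x0 \<in> X \<Longrightarrow> fst (pssm_iter X x0 m H w c t) \<in> X"
  by (cases t) (auto simp: closest_point_in split: prod.splits)

lemma pssm_sc_in: "x0 \<in> X \<Longrightarrow> 0 < T \<Longrightarrow> fst (pssm_sc X x0 m H T w c) \<in> X"
  unfolding fst_pssm_sc
  by (intro convex_sum[OF finite_lessThan X(3) pssm_weights] pssm_iter_in) auto

end

context stochastic_oracle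
begin

lemma measurable_prox:
  assumes "0 < m" "b \<in> borel_measurable N"
  shows "(\<lambda>\<omega>. prox m (b \<omega>)) \<in> borel_measurable N"
  using measurable_compose[OF assms(2) borel_measurable_continuous_onI[OF continuous_prox[OF assms(1)]]] .

lemma measurable_closest_point:
  assumes "b \<in> borel_measurable N"
  shows "(\<lambda>\<omega>. closest_point X (b \<omega>)) \<in> borel_measurable N"
  using measurable_compose[OF assms borel_measurable_continuous_onI[OF continuous_on_closest_point]] X by auto

text \<open>
  One inner loop: the method starts at \<open>x0\<close>, reads the samples from index \<open>n\<close> on, and uses the oracle
  for \<open>g x + m / 2 * x \<bullet> x - b \<bullet> x\<close>, whose minimiser over \<open>X\<close> is \<open>prox m (b \<omega>)\<close>. The number \<open>r\<close>
  bounds the shift \<open>m *\<^sub>R x - b \<omega>\<close> of the oracle on \<open>X\<close>, and \<open>B\<close> the root mean square of the shifted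
  oracle.
\<close>

context
  fixes x0 b :: "'q \<Rightarrow> 'a" and H :: "'q \<Rightarrow> 'a \<Rightarrow> 'w \<Rightarrow> 'a" and m r B :: real and n :: nat and c :: counters
  assumes x0: "x0 \<in> past n \<rightarrow>\<^sub>M borel" "\<And>\<omega>. x0 \<omega> \<in> X"
    and b: "b \<in> past n \<rightarrow>\<^sub>M borel"
    and H: "\<And>\<omega> y v. H \<omega> y v = G y v + (m *\<^sub>R y - b \<omega>)"
    and m: "0 < m"
    and shift: "\<And>\<omega> x. x \<in> X \<Longrightarrow> norm (m *\<^sub>R x - b \<omega>) \<le> r"
    and B: "2 * L\<^sup>2 + 2 * r\<^sup>2 \<le> B\<^sup>2" "0 < B"
    and c: "snd c = n"
begin

definition iterate :: "nat \<Rightarrow> 'q \<Rightarrow> 'a" where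
  "iterate t \<omega> = fst (pssm_iter X (x0 \<omega>) m (H \<omega>) (\<lambda>k. \<xi> k \<omega>) c t)"

lemma iterate_0: "iterate 0 \<omega> = x0 \<omega>" by (simp add: iterate_def)

lemma iterate_Suc:
  "iterate (Suc t) \<omega> = closest_point X (iterate t \<omega> - (2 / (m * (real t + 1))) *\<^sub>R H \<omega> (iterate t \<omega>) (\<xi> (n + t) \<omega>))"
proof -
  obtain p where cp: "c = (p, n)" using c by (cases c) auto
  show ?thesis unfolding iterate_def unfolding cp fst_pssm_iter_Suc Let_def ..
qed

lemma H_iterate: "H \<omega> (iterate t \<omega>) v = G (iterate t \<omega>) v + (m *\<^sub>R iterate t \<omega> - b \<omega>)"
  by (rule H)

lemma iterate_in: "iterate t \<omega> \<in> X"
  unfolding iterate_def by (rule pssm_iter_in[OF x0(2)])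

lemma iterate_measurable: "iterate t \<in> past (n + t) \<rightarrow>\<^sub>M borel"
proof (induction t)
  case 0
  have "iterate 0 = x0" by (simp add: fun_eq_iff iterate_0)
  then show ?case using x0 by simp
next
  case (Suc t)
  note [measurable] = measurable_past_mono[OF Suc, of "Suc (n + t)"] measurable_past_mono[OF b, of "Suc (n + t)"]
    oracle_measurable_past[OF Suc iterate_in]
  have "(\<lambda>\<omega>. iterate t \<omega> - (2 / (m * (real t + 1))) *\<^sub>R H \<omega> (iterate t \<omega>) (\<xi> (n + t) \<omega>))
      \<in> past (Suc (n + t)) \<rightarrow>\<^sub>M borel"
    unfolding H_iterate by simp
  from measurable_closest_point[OF this] show ?case by (simp add: iterate_Suc[abs_def])
qed

definition target :: "'q \<Rightarrow> 'a" where "target \<omega> = prox m (b \<omega>)"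

lemma target_in: "target \<omega> \<in> X"
  using m by (simp add: target_def prox_in)

lemma target_measurable: "n \<le> k \<Longrightarrow> target \<in> past k \<rightarrow>\<^sub>M borel"
  using measurable_prox[OF m measurable_past_mono[OF b]] by (simp add: target_def[abs_def])

definition gap :: "nat \<Rightarrow> real" where
  "gap t = (\<integral>\<omega>. (norm (iterate t \<omega> - target \<omega>))\<^sup>2 \<partial>Q)"

lemma integrable_gap: "integrable Q (\<lambda>\<omega>. (norm (iterate t \<omega> - target \<omega>))\<^sup>2)"
proof (rule Q.integrable_const_bound[of _ "D\<^sup>2"])
  show "AE \<omega> in Q. norm ((norm (iterate t \<omega> - target \<omega>))\<^sup>2) \<le> D\<^sup>2"
    using dist_le[OF iterate_in target_in] by (auto intro!: AE_I2 power_mono)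
  note [measurable] = measurable_past_imp[OF iterate_measurable] measurable_past_imp[OF target_measurable[OF order_refl]]
  show "(\<lambda>\<omega>. (norm (iterate t \<omega> - target \<omega>))\<^sup>2) \<in> borel_measurable Q" by simp
qed

lemma gap_nonneg: "0 \<le> gap t" by (simp add: gap_def)

lemma shifted_second_moment:
  "integrable Q (\<lambda>\<omega>. (norm (H \<omega> (iterate t \<omega>) (\<xi> (n + t) \<omega>)))\<^sup>2)"
  "(\<integral>\<omega>. (norm (H \<omega> (iterate t \<omega>) (\<xi> (n + t) \<omega>)))\<^sup>2 \<partial>Q) \<le> B\<^sup>2"
proof -
  note moment = oracle_second_moment[OF iterate_measurable iterate_in, of t]
  have le: "(norm (H \<omega> (iterate t \<omega>) (\<xi> (n + t) \<omega>)))\<^sup>2 \<le> 2 * (norm (G (iterate t \<omega>) (\<xi> (n + t) \<omega>)))\<^sup>2 + 2 * r\<^sup>2" for \<omega>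
  proof -
    have "(norm (m *\<^sub>R iterate t \<omega> - b \<omega>))\<^sup>2 \<le> r\<^sup>2"
      using shift[OF iterate_in, of t \<omega> \<omega>] by (simp add: power_mono)
    moreover have "(norm (u + v))\<^sup>2 \<le> 2 * (norm u)\<^sup>2 + 2 * (norm v)\<^sup>2" for u v :: 'a
      using norm_add_sq[of u v] norm_diff_sq[of u v] zero_le_power2[of "norm (u - v)"] by linarith
    ultimately show ?thesis unfolding H_iterate by (smt (verit))
  qed
  note [measurable] = measurable_past_imp[OF iterate_measurable[of t]] measurable_past_imp[OF b]
    measurable_past_imp[OF oracle_measurable_past[OF iterate_measurable iterate_in, of t]]
  have int: "integrable Q (\<lambda>\<omega>. 2 * (norm (G (iterate t \<omega>) (\<xi> (n + t) \<omega>)))\<^sup>2 + 2 * r\<^sup>2)"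
    using moment(1) by simp
  then show 1: "integrable Q (\<lambda>\<omega>. (norm (H \<omega> (iterate t \<omega>) (\<xi> (n + t) \<omega>)))\<^sup>2)"
    by (rule Bochner_Integration.integrable_bound) (use le in \<open>auto simp: H_iterate intro!: AE_I2 order_trans[OF le]\<close>)
  have "(\<integral>\<omega>. (norm (H \<omega> (iterate t \<omega>) (\<xi> (n + t) \<omega>)))\<^sup>2 \<partial>Q)
      \<le> (\<integral>\<omega>. 2 * (norm (G (iterate t \<omega>) (\<xi> (n + t) \<omega>)))\<^sup>2 + 2 * r\<^sup>2 \<partial>Q)"
    by (rule integral_mono[OF 1 int le])
  also have "\<dots> = 2 * (\<integral>\<omega>. (norm (G (iterate t \<omega>) (\<xi> (n + t) \<omega>)))\<^sup>2 \<partial>Q) + 2 * r\<^sup>2"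
    using moment(1) by (simp add: Q.prob_space)
  finally show "(\<integral>\<omega>. (norm (H \<omega> (iterate t \<omega>) (\<xi> (n + t) \<omega>)))\<^sup>2 \<partial>Q) \<le> B\<^sup>2"
    using moment(2) B(1) by linarith
qed

text \<open>
  The subgradient inequality of \<open>g\<close> at the iterate and the first-order condition at the target add
  up to strong monotonicity with modulus \<open>m\<close>. Function values cancel, so that the distance to the
  target can be followed directly.
\<close>

lemma shifted_strong_monotone:
  "integrable Q (\<lambda>\<omega>. H \<omega> (iterate t \<omega>) (\<xi> (n + t) \<omega>) \<bullet> (iterate t \<omega> - target \<omega>))"
  "m * gap t \<le> (\<integral>\<omega>. H \<omega> (iterate t \<omega>) (\<xi> (n + t) \<omega>) \<bullet> (iterate t \<omega> - target \<omega>) \<partial>Q)"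
proof -
  note sub = oracle_subgradient[OF iterate_measurable[of t] iterate_in target_measurable[of "n + t", OF le_add1] target_in]
  let ?e = "\<lambda>\<omega>. iterate t \<omega> - target \<omega>"
  have int: "integrable Q (\<lambda>\<omega>. (m *\<^sub>R iterate t \<omega> - b \<omega>) \<bullet> ?e \<omega>)"
  proof (rule Q.integrable_const_bound[of _ "r * D"])
    note [measurable] = measurable_past_imp[OF iterate_measurable] measurable_past_imp[OF b]
      measurable_past_imp[OF target_measurable[OF order_refl]]
    show "(\<lambda>\<omega>. (m *\<^sub>R iterate t \<omega> - b \<omega>) \<bullet> ?e \<omega>) \<in> borel_measurable Q" by simp
    have "\<bar>(m *\<^sub>R iterate t \<omega> - b \<omega>) \<bullet> ?e \<omega>\<bar> \<le> r * D" for \<omega>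
    proof -
      have "\<bar>(m *\<^sub>R iterate t \<omega> - b \<omega>) \<bullet> ?e \<omega>\<bar> \<le> norm (m *\<^sub>R iterate t \<omega> - b \<omega>) * norm (?e \<omega>)"
        by (rule Cauchy_Schwarz_ineq2)
      also have "\<dots> \<le> r * D"
        using shift[OF iterate_in, of t \<omega> \<omega>] dist_le[OF iterate_in target_in, of t \<omega> \<omega>]
        by (intro mult_mono) (auto intro: order_trans[OF norm_ge_zero])
      finally show ?thesis .
    qed
    then show "AE \<omega> in Q. norm ((m *\<^sub>R iterate t \<omega> - b \<omega>) \<bullet> ?e \<omega>) \<le> r * D" by simp
  qed
  have eq: "H \<omega> (iterate t \<omega>) (\<xi> (n + t) \<omega>) \<bullet> ?e \<omega>
      = G (iterate t \<omega>) (\<xi> (n + t) \<omega>) \<bullet> ?e \<omega> + (m *\<^sub>R iterate t \<omega> - b \<omega>) \<bullet> ?e \<omega>" for \<omega>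
    unfolding H_iterate by (rule inner_add_left)
  show "integrable Q (\<lambda>\<omega>. H \<omega> (iterate t \<omega>) (\<xi> (n + t) \<omega>) \<bullet> ?e \<omega>)"
    unfolding eq using sub(1) int by simp
  have "m * gap t = (\<integral>\<omega>. m * (norm (?e \<omega>))\<^sup>2 \<partial>Q)"
    by (simp add: gap_def)
  also have "\<dots> \<le> (\<integral>\<omega>. (g (iterate t \<omega>) - g (target \<omega>)) + (m *\<^sub>R iterate t \<omega> - b \<omega>) \<bullet> ?e \<omega> \<partial>Q)"
  proof (rule integral_mono)
    show "integrable Q (\<lambda>\<omega>. m * (norm (?e \<omega>))\<^sup>2)" using integrable_gap by simp
    show "integrable Q (\<lambda>\<omega>. (g (iterate t \<omega>) - g (target \<omega>)) + (m *\<^sub>R iterate t \<omega> - b \<omega>) \<bullet> ?e \<omega>)"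
      using sub(2) int by simp
    fix \<omega>
    have "g (target \<omega>) + (b \<omega> - m *\<^sub>R target \<omega>) \<bullet> ?e \<omega> \<le> g (iterate t \<omega>)"
      unfolding target_def using m iterate_in by (intro prox_subgradient) auto
    moreover have "m * (norm (?e \<omega>))\<^sup>2 = (b \<omega> - m *\<^sub>R target \<omega>) \<bullet> ?e \<omega> + (m *\<^sub>R iterate t \<omega> - b \<omega>) \<bullet> ?e \<omega>"
    proof -
      have "(b \<omega> - m *\<^sub>R target \<omega>) + (m *\<^sub>R iterate t \<omega> - b \<omega>) = m *\<^sub>R ?e \<omega>"
        by (simp add: scaleR_diff_right)
      then show ?thesis unfolding inner_add_left[symmetric] by (simp add: power2_norm_eq_inner)
    qed
    ultimately show "m * (norm (?e \<omega>))\<^sup>2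
        \<le> (g (iterate t \<omega>) - g (target \<omega>)) + (m *\<^sub>R iterate t \<omega> - b \<omega>) \<bullet> ?e \<omega>" by linarith
  qed
  also have "\<dots> \<le> (\<integral>\<omega>. H \<omega> (iterate t \<omega>) (\<xi> (n + t) \<omega>) \<bullet> ?e \<omega> \<partial>Q)"
    unfolding eq using sub int by simp
  finally show "m * gap t \<le> (\<integral>\<omega>. H \<omega> (iterate t \<omega>) (\<xi> (n + t) \<omega>) \<bullet> ?e \<omega> \<partial>Q)" .
qed

text \<open>
  The inequality for one projected step with step size \<open>s = 2 / (m * (t + 1))\<close>, multiplied by
  \<open>(t + 1)\<^sup>2\<close>. With this weight the noise term no longer depends on \<open>t\<close>.
\<close>

lemma gap_step: "4 * (real t + 1) * gap t + (real t + 1)\<^sup>2 * gap (Suc t) \<le> (real t + 1)\<^sup>2 * gap t + 4 * B\<^sup>2 / m\<^sup>2"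
proof -
  define q where "q = real t + 1"
  define s where "s = 2 / (m * q)"
  have q: "0 < q" by (simp add: q_def)
  have s: "0 < s" using m q by (simp add: s_def)
  let ?h = "\<lambda>\<omega>. H \<omega> (iterate t \<omega>) (\<xi> (n + t) \<omega>)" and ?e = "\<lambda>t \<omega>. iterate t \<omega> - target \<omega>"
  note int = shifted_second_moment(1)[of t] shifted_strong_monotone(1)[of t] integrable_gap
  have "2 * (s * (m * gap t)) \<le> 2 * (s * (\<integral>\<omega>. ?h \<omega> \<bullet> ?e t \<omega> \<partial>Q))"
    using shifted_strong_monotone(2)[of t] s by simp
  also have "\<dots> = (\<integral>\<omega>. 2 * (s * (?h \<omega> \<bullet> ?e t \<omega>)) \<partial>Q)"
    by simp
  also have "\<dots> \<le> (\<integral>\<omega>. s\<^sup>2 * (norm (?h \<omega>))\<^sup>2 + (norm (?e t \<omega>))\<^sup>2 - (norm (?e (Suc t) \<omega>))\<^sup>2 \<partial>Q)"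
  proof (rule integral_mono)
    show "integrable Q (\<lambda>\<omega>. 2 * (s * (?h \<omega> \<bullet> ?e t \<omega>)))" using int(2) by simp
    show "integrable Q (\<lambda>\<omega>. s\<^sup>2 * (norm (?h \<omega>))\<^sup>2 + (norm (?e t \<omega>))\<^sup>2 - (norm (?e (Suc t) \<omega>))\<^sup>2)"
      using int(1) int(3)[of t] int(3)[of "Suc t"] by simp
    show "2 * (s * (?h \<omega> \<bullet> ?e t \<omega>))
        \<le> s\<^sup>2 * (norm (?h \<omega>))\<^sup>2 + (norm (?e t \<omega>))\<^sup>2 - (norm (?e (Suc t) \<omega>))\<^sup>2" for \<omega>
      using projected_step[OF target_in, of s "?h \<omega>" "iterate t \<omega>" \<omega>] by (simp only: iterate_Suc s_def q_def)
  qed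
  also have "\<dots> = s\<^sup>2 * (\<integral>\<omega>. (norm (?h \<omega>))\<^sup>2 \<partial>Q) + gap t - gap (Suc t)"
    using int by (simp add: gap_def)
  also have "\<dots> \<le> s\<^sup>2 * B\<^sup>2 + gap t - gap (Suc t)"
    using shifted_second_moment(2)[of t] by (simp add: mult_left_mono)
  finally have le: "q\<^sup>2 * (2 * (s * (m * gap t))) \<le> q\<^sup>2 * (s\<^sup>2 * B\<^sup>2 + gap t - gap (Suc t))"
    by (intro mult_left_mono) auto
  have eq1: "q\<^sup>2 * (2 * (s * (m * gap t))) = 4 * q * gap t"
    using m q by (simp add: s_def field_simps power2_eq_square)
  have eq2: "q\<^sup>2 * (s\<^sup>2 * B\<^sup>2) = 4 * B\<^sup>2 / m\<^sup>2"
    using m q by (simp add: s_def field_simps power2_eq_square)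
  show ?thesis
    using le[unfolded eq1 right_diff_distrib distrib_left eq2, unfolded q_def] by linarith
qed

text \<open>
  Summing the previous inequality telescopes up to
  \<open>(t + 1)\<^sup>2 - t\<^sup>2 = 2 * t + 1\<close>, which is smaller than the coefficient \<open>4 * (t + 1)\<close> on the left by
  \<open>2 * t + 3\<close>. The sum includes a step from the iterate \<open>T - 1\<close> that the algorithm does not perform.
  This is harmless, since the iterate \<open>T\<close> enters only through a nonnegative term that is dropped.
\<close>

lemma weighted_gap_sum: "(\<Sum>t<T. (real t + 1) * gap t) \<le> 2 * real T * B\<^sup>2 / m\<^sup>2"
proof -
  define K where "K = 4 * B\<^sup>2 / m\<^sup>2"
  have "(\<Sum>t<T. (2 * real t + 3) * gap t) + (real T)\<^sup>2 * gap T \<le> real T * K"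
  proof (induction T)
    case (Suc T)
    with gap_step[of T, folded K_def] show ?case by (simp add: algebra_simps power2_eq_square)
  qed simp
  moreover have "0 \<le> (real T)\<^sup>2 * gap T" by (simp add: gap_nonneg)
  moreover have "2 * (\<Sum>t<T. (real t + 1) * gap t) \<le> (\<Sum>t<T. (2 * real t + 3) * gap t)"
    unfolding sum_distrib_left
  proof (rule sum_mono)
    fix t show "2 * ((real t + 1) * gap t) \<le> (2 * real t + 3) * gap t"
      using gap_nonneg[of t] by (simp add: algebra_simps)
  qed
  moreover have "real T * K = 2 * (2 * real T * B\<^sup>2 / m\<^sup>2)" by (simp add: K_def)
  ultimately show ?thesis by linarith
qed

definition average :: "nat \<Rightarrow> 'q \<Rightarrow> 'a" where
  "average T \<omega> = fst (pssm_sc X (x0 \<omega>) m (H \<omega>) T (\<lambda>k. \<xi> k \<omega>) c)"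

lemma average_eq: "average T \<omega> = (\<Sum>t<T. (2 / (real T * (real T + 1)) * (real t + 1)) *\<^sub>R iterate t \<omega>)"
  by (simp add: average_def fst_pssm_sc iterate_def)

lemma average_in: "0 < T \<Longrightarrow> average T \<omega> \<in> X"
  unfolding average_def by (rule pssm_sc_in[OF x0(2)])

lemma average_measurable: "average T \<in> past (n + (T - 1)) \<rightarrow>\<^sub>M borel"
proof -
  have "iterate t \<in> past (n + (T - 1)) \<rightarrow>\<^sub>M borel" if "t < T" for t
    using that by (intro measurable_past_mono[OF iterate_measurable]) auto
  then show ?thesis unfolding average_eq[abs_def] by (intro borel_measurable_sum borel_measurable_scaleR) auto
qed

lemma integrable_average_error: "0 < T \<Longrightarrow> integrable Q (\<lambda>\<omega>. norm (average T \<omega> - target \<omega>))"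
proof (rule Q.integrable_const_bound[of _ D])
  assume T: "0 < T"
  show "AE \<omega> in Q. norm (norm (average T \<omega> - target \<omega>)) \<le> D"
    using dist_le[OF average_in[OF T] target_in] by (auto intro!: AE_I2)
  note [measurable] = measurable_past_imp[OF average_measurable] measurable_past_imp[OF target_measurable[OF order_refl]]
  show "(\<lambda>\<omega>. norm (average T \<omega> - target \<omega>)) \<in> borel_measurable Q" by simp
qed

text \<open>
  The weighted mean of the mean square errors of the iterates is at most \<open>\<alpha>\<^sup>2\<close> with
  \<open>\<alpha> = 2 * B / (m * sqrt (T + 1))\<close>. The passage to the first moment for the average is made pointwise,
  by the triangle inequality and \<open>x \<le> x\<^sup>2 / (2 * \<alpha>) + \<alpha> / 2\<close>.
\<close>

lemma average_error:
  assumes T: "0 < T"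
  shows "(\<integral>\<omega>. norm (average T \<omega> - target \<omega>) \<partial>Q) \<le> 2 * B / (m * sqrt (real T + 1))"
proof -
  define k where "k t = 2 / (real T * (real T + 1)) * (real t + 1)" for t
  define \<alpha> where "\<alpha> = 2 * B / (m * sqrt (real T + 1))"
  have \<alpha>: "0 < \<alpha>" using B m by (simp add: \<alpha>_def)
  have k: "0 \<le> k t" for t by (simp add: k_def)
  have k1: "(\<Sum>t<T. k t) = 1" using pssm_weights[OF T] by (simp add: k_def)
  have pointwise: "norm (average T \<omega> - target \<omega>)
      \<le> (\<Sum>t<T. k t / (2 * \<alpha>) * (norm (iterate t \<omega> - target \<omega>))\<^sup>2) + \<alpha> / 2" for \<omega>
  proof -
    have "average T \<omega> - target \<omega> = (\<Sum>t<T. k t *\<^sub>R iterate t \<omega>) - (\<Sum>t<T. k t) *\<^sub>R target \<omega>"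
      by (simp only: average_eq k_def[symmetric] k1 scaleR_one)
    also have "\<dots> = (\<Sum>t<T. k t *\<^sub>R (iterate t \<omega> - target \<omega>))"
      by (simp add: scaleR_sum_left scaleR_diff_right sum_subtractf)
    finally have "norm (average T \<omega> - target \<omega>) \<le> (\<Sum>t<T. k t * norm (iterate t \<omega> - target \<omega>))"
      using k by (simp add: sum_norm_le)
    also have "\<dots> \<le> (\<Sum>t<T. k t / (2 * \<alpha>) * (norm (iterate t \<omega> - target \<omega>))\<^sup>2 + k t * (\<alpha> / 2))"
    proof (rule sum_mono)
      fix t
      let ?x = "norm (iterate t \<omega> - target \<omega>)"
      have "?x \<le> ?x\<^sup>2 / (2 * \<alpha>) + \<alpha> / 2"
        using zero_le_power2[of "?x - \<alpha>"] \<alpha> by (simp add: field_simps power2_eq_square)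
      from mult_left_mono[OF this k[of t]]
      show "k t * ?x \<le> k t / (2 * \<alpha>) * ?x\<^sup>2 + k t * (\<alpha> / 2)" by (simp add: algebra_simps)
    qed
    also have "\<dots> = (\<Sum>t<T. k t / (2 * \<alpha>) * (norm (iterate t \<omega> - target \<omega>))\<^sup>2) + \<alpha> / 2"
      by (simp only: sum.distrib sum_distrib_right[symmetric] k1 mult_1)
    finally show ?thesis .
  qed
  have int: "integrable Q (\<lambda>\<omega>. (\<Sum>t<T. k t / (2 * \<alpha>) * (norm (iterate t \<omega> - target \<omega>))\<^sup>2))"
    using integrable_gap by (intro Bochner_Integration.integrable_sum integrable_mult_right)
  have "(\<integral>\<omega>. norm (average T \<omega> - target \<omega>) \<partial>Q)
      \<le> (\<integral>\<omega>. (\<Sum>t<T. k t / (2 * \<alpha>) * (norm (iterate t \<omega> - target \<omega>))\<^sup>2) + \<alpha> / 2 \<partial>Q)"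
    using int by (intro integral_mono integrable_average_error[OF T] pointwise) simp
  also have "\<dots> = (\<Sum>t<T. k t / (2 * \<alpha>) * gap t) + \<alpha> / 2"
    using int integrable_gap by (simp add: gap_def Q.prob_space)
  also have "(\<Sum>t<T. k t / (2 * \<alpha>) * gap t)
      = (\<Sum>t<T. (real t + 1) * gap t) / (\<alpha> * (real T * (real T + 1)))"
  proof -
    have "2 / c * x / (2 * a) * y = x * y / (a * c)" for a c x y :: real
      by (cases "a = 0"; cases "c = 0") (simp_all add: field_simps)
    then show ?thesis unfolding sum_divide_distrib k_def by (intro sum.cong refl)
  qed
  also have "\<dots> \<le> (2 * real T * B\<^sup>2 / m\<^sup>2) / (\<alpha> * (real T * (real T + 1)))"
    using weighted_gap_sum[of T] \<alpha> by (intro divide_right_mono) auto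
  also have "2 * real T * B\<^sup>2 / m\<^sup>2 = \<alpha>\<^sup>2 * (real T * (real T + 1)) / 2"
  proof -
    have "\<alpha>\<^sup>2 = 4 * B\<^sup>2 / m\<^sup>2 / (real T + 1)"
      by (simp add: \<alpha>_def power_divide power_mult_distrib)
    then have "\<alpha>\<^sup>2 * (real T + 1) = 4 * B\<^sup>2 / m\<^sup>2" by simp
    then have "\<alpha>\<^sup>2 * (real T * (real T + 1)) = real T * (4 * B\<^sup>2 / m\<^sup>2)"
      by (simp only: mult.left_commute[of "\<alpha>\<^sup>2"])
    then show ?thesis by simp
  qed
  also have "\<dots> / (\<alpha> * (real T * (real T + 1))) = \<alpha>\<^sup>2 / (2 * \<alpha>)"
  proof -
    have "x * c / 2 / (a * c) = x / (2 * a)" if "c \<noteq> 0" for a c x :: real using that by simp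
    then show ?thesis using T by simp
  qed
  also have "\<dots> = \<alpha> / 2" using \<alpha> by (simp add: power2_eq_square)
  finally show ?thesis by (simp add: \<alpha>_def)
qed

lemma pssm_sc_measurable:
  "(\<lambda>\<omega>. fst (pssm_sc X (x0 \<omega>) m (H \<omega>) T (\<lambda>k. \<xi> k \<omega>) c)) \<in> past (n + (T - 1)) \<rightarrow>\<^sub>M borel"
  using average_measurable[of T] unfolding average_def[abs_def] .

lemma pssm_sc_error:
  assumes "0 < T"
  shows "integrable Q (\<lambda>\<omega>. norm (fst (pssm_sc X (x0 \<omega>) m (H \<omega>) T (\<lambda>k. \<xi> k \<omega>) c) - prox m (b \<omega>)))"
    and "(\<integral>\<omega>. norm (fst (pssm_sc X (x0 \<omega>) m (H \<omega>) T (\<lambda>k. \<xi> k \<omega>) c) - prox m (b \<omega>)) \<partial>Q)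
      \<le> 2 * B / (m * sqrt (real T + 1))"
  using integrable_average_error[OF assms] average_error[OF assms] unfolding average_def target_def .

end

end

section \<open>The outer loop of gradual regularization\<close>

definition modulus :: "real \<Rightarrow> nat \<Rightarrow> real" where
  "modulus \<mu> i = (\<Sum>j\<le>i. \<mu> * 2 ^ j)"

lemma modulus_eq: "modulus \<mu> i = \<mu> * (2 ^ (i + 1) - 1)"
  by (induction i) (auto simp: modulus_def algebra_simps)

lemma modulus_0: "modulus \<mu> 0 = \<mu>"
  by (simp add: modulus_def)

lemma modulus_Suc: "modulus \<mu> (Suc i) = modulus \<mu> i + \<mu> * 2 ^ (i + 1)"
  by (simp add: modulus_def)

lemma modulus_ge: "0 < \<mu> \<Longrightarrow> \<mu> \<le> modulus \<mu> i"
  by (simp add: modulus_eq algebra_simps)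

lemma modulus_mono: "0 < \<mu> \<Longrightarrow> i \<le> k \<Longrightarrow> modulus \<mu> i \<le> modulus \<mu> k"
  by (simp add: modulus_eq)

lemma modulus_Suc_le: "0 < \<mu> \<Longrightarrow> modulus \<mu> (Suc i) \<le> 3 * modulus \<mu> i"
  using modulus_ge[of \<mu> i] by (simp add: modulus_eq algebra_simps)

definition outer where
  "outer X xc \<mu> G T w i = fst (gr_sc_iter X xc \<mu> (\<lambda>y v. G y v + \<mu> *\<^sub>R (y - xc)) T w (0, 0) i)"

text \<open>
  The objective of stage \<open>i\<close> is \<open>g x + modulus \<mu> i / 2 * x \<bullet> x - anchor i \<bullet> x\<close> up to a constant, so its
  minimiser is \<open>reg_min X g (modulus \<mu> i) (anchor i)\<close>.
\<close>

definition anchor where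
  "anchor X xc \<mu> G T w i = \<mu> *\<^sub>R xc + (\<Sum>j=1..i. (\<mu> * 2 ^ j) *\<^sub>R outer X xc \<mu> G T w j)"

lemma anchor_0: "anchor X xc \<mu> G T w 0 = \<mu> *\<^sub>R xc"
  by (simp add: anchor_def)

lemma anchor_Suc:
  "anchor X xc \<mu> G T w (Suc i) = anchor X xc \<mu> G T w i + (\<mu> * 2 ^ (i + 1)) *\<^sub>R outer X xc \<mu> G T w (Suc i)"
  by (simp add: anchor_def)

lemma outer_0: "outer X xc \<mu> G T w 0 = xc"
  by (simp add: outer_def)

lemma gr_sc_iter_eq:
  "gr_sc_iter X xc \<mu> (\<lambda>y v. G y v + \<mu> *\<^sub>R (y - xc)) T w (0, 0) i =
    (outer X xc \<mu> G T w i, \<lambda>y v. G y v + (modulus \<mu> i *\<^sub>R y - anchor X xc \<mu> G T w i),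
     (i * (T - 1), i * (T - 1)))"
proof (induction i)
  case 0
  show ?case by (simp add: outer_0 anchor_0 modulus_0 scaleR_diff_right)
next
  case (Suc i)
  let ?I = "gr_sc_iter X xc \<mu> (\<lambda>y v. G y v + \<mu> *\<^sub>R (y - xc)) T w (0, 0)"
  let ?H = "\<lambda>y v. G y v + (modulus \<mu> i *\<^sub>R y - anchor X xc \<mu> G T w i)"
  let ?k = "(i * (T - 1), i * (T - 1))"
  obtain x' k' where p: "pssm_sc X (outer X xc \<mu> G T w i) (\<Sum>j\<le>i. \<mu> * 2 ^ j) ?H T w ?k = (x', k')"
    by (meson surj_pair)
  have step: "?I (Suc i) = (x', \<lambda>y v. ?H y v + (\<mu> * 2 ^ (i + 1)) *\<^sub>R (y - x'), k')"
    unfolding gr_sc_iter.simps Suc prod.case p ..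
  then have x': "x' = outer X xc \<mu> G T w (Suc i)"
    by (simp only: outer_def fst_conv)
  have "k' = snd (pssm_sc X (outer X xc \<mu> G T w i) (\<Sum>j\<le>i. \<mu> * 2 ^ j) ?H T w ?k)"
    unfolding p snd_conv ..
  then have k': "k' = (Suc i * (T - 1), Suc i * (T - 1))"
    by (simp add: pssm_sc_def snd_pssm_iter)
  have "?H y v + (\<mu> * 2 ^ (i + 1)) *\<^sub>R (y - x')
      = G y v + (modulus \<mu> (Suc i) *\<^sub>R y - anchor X xc \<mu> G T w (Suc i))" for y v
    unfolding modulus_Suc anchor_Suc x'[symmetric] by (simp only: scaleR_diff_right scaleR_add_left) simp
  then show ?case unfolding step x'[symmetric] k' by (simp only:)
qed

lemma outer_Suc:
  "outer X xc \<mu> G T w (Suc i) =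
    fst (pssm_sc X (outer X xc \<mu> G T w i) (modulus \<mu> i)
      (\<lambda>y v. G y v + (modulus \<mu> i *\<^sub>R y - anchor X xc \<mu> G T w i)) T w (i * (T - 1), i * (T - 1)))"
  unfolding outer_def[of X xc \<mu> G T w "Suc i"]
  by (simp add: gr_sc_iter_eq modulus_def split: prod.splits)

text \<open>
  When \<open>l / 2\<close> is the sum of the weights \<open>\<mu> * 2 ^ i\<close> for \<open>1 \<le> i \<le> I\<close>, the output is the mean,
  with respect to the weights, of the centres of all quadratics that were added and of one last
  quadratic of weight \<open>l / 2\<close> centred at the last iterate. Hence its proximal point is the minimiser of the fully regularised objective.
\<close>

lemma gr_eq:
  assumes l: "(\<Sum>i=1..I. \<mu> * 2 ^ i) = l / 2" "0 < l" "0 < \<mu>"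
  shows "gr X xc \<mu> l T I G w =
    ((1 / (\<mu> + l)) *\<^sub>R (anchor X xc \<mu> G T w I + (l / 2) *\<^sub>R outer X xc \<mu> G T w (Suc I)),
     ((I + 1) * (T - 1), (I + 1) * (T - 1)))"
proof -
  let ?S = "\<Sum>i=1..I. (\<mu> * 2 ^ i) *\<^sub>R outer X xc \<mu> G T w i"
  let ?x = "outer X xc \<mu> G T w (Suc I)"
  have "gr_sc X xc \<mu> (l / 2) T I (\<lambda>y v. G y v + \<mu> *\<^sub>R (y - xc)) w (0, 0)
      = ((1 / l) *\<^sub>R ((l / 2) *\<^sub>R ?x + ?S), ((I + 1) * (T - 1), (I + 1) * (T - 1)))"
    unfolding gr_sc_def gr_sc_iter_eq l(1) by simp
  moreover have "(\<mu> / (\<mu> + l)) *\<^sub>R xc + (l / (\<mu> + l)) *\<^sub>R ((1 / l) *\<^sub>R ((l / 2) *\<^sub>R ?x + ?S))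
      = (1 / (\<mu> + l)) *\<^sub>R (anchor X xc \<mu> G T w I + (l / 2) *\<^sub>R ?x)"
  proof -
    have "(1 / (\<mu> + l)) *\<^sub>R (\<mu> *\<^sub>R xc + ((l / 2) *\<^sub>R ?x + ?S))
        = (\<mu> / (\<mu> + l)) *\<^sub>R xc + (l / (\<mu> + l)) *\<^sub>R ((1 / l) *\<^sub>R ((l / 2) *\<^sub>R ?x + ?S))"
      using l(2) by (simp only: scaleR_add_right[of _ "\<mu> *\<^sub>R xc"] scaleR_scaleR) simp
    then show ?thesis by (simp add: anchor_def add_ac)
  qed
  ultimately show ?thesis by (simp add: gr_def)
qed

context constrained_problem
begin

lemma weighted_mean_in:
  assumes "0 < m" "0 \<le> n" "(1 / m) *\<^sub>R b \<in> X" "x \<in> X"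
  shows "(1 / (m + n)) *\<^sub>R (b + n *\<^sub>R x) \<in> X"
proof -
  have "(m / (m + n)) *\<^sub>R ((1 / m) *\<^sub>R b) + (n / (m + n)) *\<^sub>R x \<in> X"
    using assms X(3) by (intro convexD) (auto simp: add_divide_distrib[symmetric])
  moreover have "(m / (m + n)) *\<^sub>R ((1 / m) *\<^sub>R b) + (n / (m + n)) *\<^sub>R x = (1 / (m + n)) *\<^sub>R (b + n *\<^sub>R x)"
    using assms(1) by (simp add: scaleR_add_right)
  ultimately show ?thesis by simp
qed

lemma shift_le:
  assumes "0 < m" "(1 / m) *\<^sub>R b \<in> X" "x \<in> X"
  shows "norm (m *\<^sub>R x - b) \<le> m * D"
proof -
  have "m *\<^sub>R x - b = m *\<^sub>R (x - (1 / m) *\<^sub>R b)"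
    using assms(1) by (simp add: scaleR_diff_right)
  then show ?thesis using dist_le[OF assms(3,2)] assms(1) by (simp add: mult_left_mono)
qed

lemma run_in:
  assumes xc: "xc \<in> X" and \<mu>: "0 < \<mu>" and T: "0 < T"
  shows outer_in: "outer X xc \<mu> G T w i \<in> X"
    and anchor_in: "(1 / modulus \<mu> i) *\<^sub>R anchor X xc \<mu> G T w i \<in> X"
proof -
  have out: "outer X xc \<mu> G T w i \<in> X" for i
    by (induction i) (simp_all add: outer_0 xc outer_Suc pssm_sc_in T)
  then show "outer X xc \<mu> G T w i \<in> X" .
  show "(1 / modulus \<mu> i) *\<^sub>R anchor X xc \<mu> G T w i \<in> X"
  proof (induction i)
    case 0
    then show ?case using xc \<mu> by (simp add: anchor_0 modulus_0)
  next
    case (Suc i)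
    then show ?case unfolding modulus_Suc anchor_Suc
      using out \<mu> modulus_ge[OF \<mu>, of i] by (intro weighted_mean_in) auto
  qed
qed

text \<open>
  The summand \<open>\<mu> * D\<close> is the residual of the first stage, where only the quadratic centred at \<open>xc\<close> is
  present; each later stage contributes by \<open>residual_growth\<close>.
\<close>

lemma anchor_residual:
  fixes G :: "'a \<Rightarrow> 'w \<Rightarrow> 'a" and w :: "nat \<Rightarrow> 'w" and T :: nat
  assumes \<mu>: "0 < \<mu>" and xc: "xc \<in> X"
  defines "x \<equiv> outer X xc \<mu> G T w" and "b \<equiv> anchor X xc \<mu> G T w"
  shows "norm (b k - modulus \<mu> k *\<^sub>R prox (modulus \<mu> k) (b k))
    \<le> \<mu> * D + (\<Sum>i<k. modulus \<mu> (Suc i) * norm (x (Suc i) - prox (modulus \<mu> i) (b i)))"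
proof (induction k)
  case 0
  have "norm (\<mu> *\<^sub>R (xc - prox \<mu> (\<mu> *\<^sub>R xc))) \<le> \<mu> * D"
    using dist_le[OF xc prox_in, of \<mu>] \<mu> by (simp add: mult_left_mono)
  then show ?case by (simp add: b_def anchor_0 modulus_0 scaleR_diff_right)
next
  case (Suc k)
  have "0 < modulus \<mu> k" using modulus_ge[OF \<mu>, of k] \<mu> by simp
  from residual_growth[OF this, of "\<mu> * 2 ^ (k + 1)" "b k" "x (Suc k)"] \<mu> Suc
  show ?case unfolding modulus_Suc b_def x_def anchor_Suc by (simp add: modulus_Suc)
qed

end

context stochastic_oracle
begin

context
  fixes xc :: 'a and \<mu> r B :: real and T I :: nat
  assumes xc: "xc \<in> X" and \<mu>: "0 < \<mu>" and T: "0 < T"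
    and r: "modulus \<mu> I * D \<le> r" and B: "2 * L\<^sup>2 + 2 * r\<^sup>2 \<le> B\<^sup>2" "0 < B"
begin

abbreviation "out i \<omega> \<equiv> outer X xc \<mu> G T (\<lambda>k. \<xi> k \<omega>) i"
abbreviation "anc i \<omega> \<equiv> anchor X xc \<mu> G T (\<lambda>k. \<xi> k \<omega>) i"
abbreviation "md \<equiv> modulus \<mu>"

lemma md_pos: "0 < md i"
  using modulus_ge[OF \<mu>, of i] \<mu> by simp

lemmas out_in = outer_in[OF xc \<mu> T] and anc_in = anchor_in[OF xc \<mu> T]

lemma anc_measurable:
  assumes "\<And>j. j \<le> i \<Longrightarrow> out j \<in> past (j * (T - 1)) \<rightarrow>\<^sub>M borel"
  shows "anc i \<in> past (i * (T - 1)) \<rightarrow>\<^sub>M borel"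
proof -
  have "out j \<in> past (i * (T - 1)) \<rightarrow>\<^sub>M borel" if "j \<le> i" for j
    using that by (intro measurable_past_mono[OF assms]) auto
  then show ?thesis unfolding anchor_def[abs_def] by (intro borel_measurable_add borel_measurable_sum borel_measurable_scaleR) auto
qed

lemma shift_le_r: "i \<le> I \<Longrightarrow> x \<in> X \<Longrightarrow> norm (md i *\<^sub>R x - anc i \<omega>) \<le> r"
proof -
  assume "i \<le> I" and x: "x \<in> X"
  have "norm (md i *\<^sub>R x - anc i \<omega>) \<le> md i * D"
    by (rule shift_le[OF md_pos anc_in x])
  also have "\<dots> \<le> md I * D"
    using modulus_mono[OF \<mu> \<open>i \<le> I\<close>] X(6) by (simp add: mult_right_mono)
  finally show ?thesis using r by simp
qed

lemma out_measurable: "i \<le> Suc I \<Longrightarrow> out i \<in> past (i * (T - 1)) \<rightarrow>\<^sub>M borel"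
proof (induction i rule: less_induct)
  case (less i)
  show ?case
  proof (cases i)
    case 0
    then show ?thesis by (simp add: outer_0[abs_def])
  next
    case (Suc k)
    have k: "k \<le> I" using less.prems Suc by simp
    have "out j \<in> past (j * (T - 1)) \<rightarrow>\<^sub>M borel" if "j \<le> k" for j
      using less that Suc by simp
    note meas = this[OF order_refl] anc_measurable[OF this]
    have "(\<lambda>\<omega>. fst (pssm_sc X (out k \<omega>) (md k) (\<lambda>y v. G y v + (md k *\<^sub>R y - anc k \<omega>)) T (\<lambda>k. \<xi> k \<omega>)
        (k * (T - 1), k * (T - 1)))) \<in> past (k * (T - 1) + (T - 1)) \<rightarrow>\<^sub>M borel"
      by (rule pssm_sc_measurable[OF meas(1) out_in meas(2) refl md_pos shift_le_r[OF k] B snd_conv])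
    then show ?thesis by (simp add: Suc outer_Suc[abs_def] add.commute)
  qed
qed

definition err :: "nat \<Rightarrow> 'q \<Rightarrow> real" where
  "err i \<omega> = norm (out (Suc i) \<omega> - prox (md i) (anc i \<omega>))"

lemma err_bound:
  assumes i: "i \<le> I"
  shows "integrable Q (err i)"
    and "(\<integral>\<omega>. err i \<omega> \<partial>Q) \<le> 2 * B / (md i * sqrt (real T + 1))"
proof -
  have "out j \<in> past (j * (T - 1)) \<rightarrow>\<^sub>M borel" if "j \<le> i" for j
    using out_measurable that i by simp
  note meas = this[OF order_refl] anc_measurable[OF this]
  note stage = pssm_sc_error[OF meas(1) out_in meas(2) refl md_pos shift_le_r[OF i] B snd_conv T]
  show "integrable Q (err i)"
    unfolding err_def[abs_def] outer_Suc by (rule stage(1))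
  show "(\<integral>\<omega>. err i \<omega> \<partial>Q) \<le> 2 * B / (md i * sqrt (real T + 1))"
    unfolding err_def outer_Suc by (rule stage(2))
qed

text \<open>
  The stage errors are of order \<open>B / (modulus \<mu> i * sqrt (T + 1))\<close>, and stage \<open>i\<close> is charged with the
  factor \<open>modulus \<mu> (Suc i) \<le> 3 * modulus \<mu> i\<close>. The moduli cancel, and every stage has the same
  bound. The weights grow geometrically in order to keep this factor bounded with only logarithmically
  many stages.
\<close>

lemma final_residual:
  fixes n :: real
  assumes n: "0 \<le> n" "n \<le> md I"
  defines "b \<equiv> \<lambda>\<omega>. anc I \<omega> + n *\<^sub>R out (Suc I) \<omega>"
  defines "res \<equiv> \<lambda>\<omega>. norm (b \<omega> - (md I + n) *\<^sub>R prox (md I + n) (b \<omega>))"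
  shows "integrable Q res"
    and "(\<integral>\<omega>. res \<omega> \<partial>Q) \<le> \<mu> * D + (6 * real I + 4) * B / sqrt (real T + 1)"
proof -
  define s where "s = sqrt (real T + 1)"
  have s: "0 < s" by (simp add: s_def)
  define bd where "bd \<omega> = \<mu> * D + (\<Sum>i<I. md (Suc i) * err i \<omega>) + (md I + n) * err I \<omega>" for \<omega>
  have le: "res \<omega> \<le> bd \<omega>" for \<omega>
  proof -
    have "res \<omega> \<le> norm (anc I \<omega> - md I *\<^sub>R prox (md I) (anc I \<omega>)) + (md I + n) * err I \<omega>"
      unfolding res_def b_def err_def by (rule residual_growth[OF md_pos n(1)])
    also have "norm (anc I \<omega> - md I *\<^sub>R prox (md I) (anc I \<omega>)) \<le> \<mu> * D + (\<Sum>i<I. md (Suc i) * err i \<omega>)"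
      unfolding err_def by (rule anchor_residual[OF \<mu> xc])
    finally show ?thesis by (simp add: bd_def)
  qed
  have "out (Suc I) \<in> borel_measurable Q" "anc I \<in> borel_measurable Q"
    using measurable_past_imp[OF out_measurable] measurable_past_imp[OF anc_measurable] out_measurable by auto
  then have b: "b \<in> borel_measurable Q" unfolding b_def by measurable
  have pos: "0 < md I + n" using md_pos[of I] n by simp
  have res: "res \<in> borel_measurable Q"
    unfolding res_def using measurable_prox[OF pos b] b by measurable
  have sum_int: "integrable Q (\<lambda>\<omega>. \<Sum>i<I. md (Suc i) * err i \<omega>)"
    using err_bound(1) by (intro Bochner_Integration.integrable_sum integrable_mult_right) auto
  have last_int: "integrable Q (\<lambda>\<omega>. (md I + n) * err I \<omega>)"
    using err_bound(1)[OF order_refl] by (rule integrable_mult_right)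
  have bd: "integrable Q bd"
    unfolding bd_def using sum_int last_int by simp
  show int: "integrable Q res"
  proof (rule Bochner_Integration.integrable_bound[OF bd res])
    have "norm (res \<omega>) \<le> norm (bd \<omega>)" for \<omega>
      using le[of \<omega>] by (simp add: res_def)
    then show "AE \<omega> in Q. norm (res \<omega>) \<le> norm (bd \<omega>)" by simp
  qed
  have "(\<integral>\<omega>. res \<omega> \<partial>Q) \<le> (\<integral>\<omega>. bd \<omega> \<partial>Q)"
    by (rule integral_mono[OF int bd le])
  also have "\<dots> = \<mu> * D + (\<Sum>i<I. md (Suc i) * (\<integral>\<omega>. err i \<omega> \<partial>Q)) + (md I + n) * (\<integral>\<omega>. err I \<omega> \<partial>Q)"
  proof -
    have "(\<integral>\<omega>. (\<Sum>i<I. md (Suc i) * err i \<omega>) \<partial>Q) = (\<Sum>i<I. md (Suc i) * (\<integral>\<omega>. err i \<omega> \<partial>Q))"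
      using err_bound(1) by (subst Bochner_Integration.integral_sum) (auto intro: integrable_mult_right)
    moreover have "(\<integral>\<omega>. bd \<omega> \<partial>Q)
        = (\<integral>\<omega>. \<mu> * D + (\<Sum>i<I. md (Suc i) * err i \<omega>) \<partial>Q) + (\<integral>\<omega>. (md I + n) * err I \<omega> \<partial>Q)"
      unfolding bd_def using sum_int by (intro Bochner_Integration.integral_add[OF _ last_int]) simp
    moreover have "(\<integral>\<omega>. \<mu> * D + (\<Sum>i<I. md (Suc i) * err i \<omega>) \<partial>Q)
        = \<mu> * D + (\<integral>\<omega>. (\<Sum>i<I. md (Suc i) * err i \<omega>) \<partial>Q)"
      by (subst Bochner_Integration.integral_add[OF _ sum_int]) (simp_all add: Q.prob_space)
    ultimately show ?thesis by simp
  qed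
  also have "\<dots> \<le> \<mu> * D + (\<Sum>i<I. 6 * B / s) + 4 * B / s"
  proof (intro add_mono order_refl sum_mono)
    have scale: "k * (\<integral>\<omega>. err i \<omega> \<partial>Q) \<le> 2 * c * B / s" if "i \<le> I" "0 \<le> k" "k \<le> c * md i" for i k c
    proof -
      have "k * (\<integral>\<omega>. err i \<omega> \<partial>Q) \<le> k * (2 * B / (md i * s))"
        using mult_left_mono[OF err_bound(2)[OF that(1)] that(2)] unfolding s_def .
      also have "\<dots> \<le> (c * md i) * (2 * B / (md i * s))"
        using that(3) md_pos[of i] s B(2) by (intro mult_right_mono) auto
      also have "\<dots> = 2 * c * B / s" using md_pos[of i] by simp
      finally show ?thesis .
    qed
    show "md (Suc i) * (\<integral>\<omega>. err i \<omega> \<partial>Q) \<le> 6 * B / s" if "i \<in> {..<I}" for i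
      using scale[of i "md (Suc i)" 3] that modulus_Suc_le[OF \<mu>, of i] md_pos[of "Suc i"] by simp
    show "(md I + n) * (\<integral>\<omega>. err I \<omega> \<partial>Q) \<le> 4 * B / s"
      using scale[of I "md I + n" 2] n pos by simp
  qed
  also have "\<dots> = \<mu> * D + (6 * real I + 4) * B / s"
    by (simp add: add_divide_distrib algebra_simps)
  finally show "(\<integral>\<omega>. res \<omega> \<partial>Q) \<le> \<mu> * D + (6 * real I + 4) * B / sqrt (real T + 1)"
    unfolding s_def .
qed

end

end


section \<open>Counting oracle calls\<close>

lemma gr_horizon_spec:
  assumes "0 < \<epsilon>"
  shows "0 < gr_horizon L D \<rho> \<epsilon>" "gr_bound L D \<rho> \<epsilon> (gr_horizon L D \<rho> \<epsilon>) \<le> \<epsilon>"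
proof -
  define K where "K = (28 * sqrt 2 * log 2 (3/4 + \<rho> * D / \<epsilon>)) * sqrt (2 * L\<^sup>2 + 3 * \<rho>\<^sup>2 * D\<^sup>2)"
  obtain T :: nat where "(2 * K / \<epsilon>)\<^sup>2 \<le> real T" using real_arch_simple by blast
  then have "2 * K / \<epsilon> \<le> sqrt (real (Suc T) + 1)" by (intro real_le_rsqrt) simp
  then have "K / sqrt (real (Suc T) + 1) \<le> \<epsilon> / 2"
    using assms by (simp add: field_simps)
  then have "0 < Suc T \<and> gr_bound L D \<rho> \<epsilon> (Suc T) \<le> \<epsilon>"
    unfolding gr_bound_def K_def by simp
  from LeastI[of "\<lambda>T. 0 < T \<and> gr_bound L D \<rho> \<epsilon> T \<le> \<epsilon>", OF this]
  show "0 < gr_horizon L D \<rho> \<epsilon>" "gr_bound L D \<rho> \<epsilon> (gr_horizon L D \<rho> \<epsilon>) \<le> \<epsilon>"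
    unfolding gr_horizon_def by auto
qed

text \<open>
  Minimality of the horizon \<open>T\<close> means that \<open>T - 1\<close> violates the accuracy requirement, unless it is \<open>0\<close>.
  Solving the violated inequality for \<open>T\<close> gives the bound, with \<open>6272 = (56 * sqrt 2)\<^sup>2\<close>.
\<close>

lemma gr_horizon_le:
  fixes L D \<rho> \<epsilon> :: real
  assumes "0 < \<epsilon>" "0 \<le> log 2 (3/4 + \<rho> * D / \<epsilon>)"
  shows "real (gr_horizon L D \<rho> \<epsilon> - 1)
    \<le> 6272 * (log 2 (3/4 + \<rho> * D / \<epsilon>))\<^sup>2 * (2 * L\<^sup>2 + 3 * \<rho>\<^sup>2 * D\<^sup>2) / \<epsilon>\<^sup>2"
proof (cases "gr_horizon L D \<rho> \<epsilon> = 1")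
  case True
  then show ?thesis by simp
next
  case False
  let ?T = "gr_horizon L D \<rho> \<epsilon>"
  define a where "a = log 2 (3/4 + \<rho> * D / \<epsilon>)"
  define c where "c = 2 * L\<^sup>2 + 3 * \<rho>\<^sup>2 * D\<^sup>2"
  have c: "0 \<le> c" by (simp add: c_def)
  have T: "1 < ?T" using False gr_horizon_spec(1)[OF assms(1), of L D \<rho>] by linarith
  have "\<not> (0 < ?T - 1 \<and> gr_bound L D \<rho> \<epsilon> (?T - 1) \<le> \<epsilon>)"
    using T unfolding gr_horizon_def by (intro not_less_Least) simp
  then have "\<epsilon> / 2 < (28 * sqrt 2 * a) * sqrt c / sqrt (real ?T)"
    using T by (simp add: gr_bound_def a_def c_def of_nat_diff)
  then have "\<epsilon> * sqrt (real ?T) < 56 * sqrt 2 * a * sqrt c"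
    using T by (simp add: field_simps)
  then have "(\<epsilon> * sqrt (real ?T))\<^sup>2 \<le> (56 * sqrt 2 * a * sqrt c)\<^sup>2"
    using assms(1) by (intro power_mono) auto
  then have "\<epsilon>\<^sup>2 * real ?T \<le> 6272 * a\<^sup>2 * c"
    using c by (simp add: power_mult_distrib)
  then have "real ?T \<le> 6272 * a\<^sup>2 * c / \<epsilon>\<^sup>2"
    using assms(1) by (simp add: field_simps)
  then show ?thesis using T unfolding a_def c_def by (simp add: of_nat_diff)
qed

text \<open>
  The constant \<open>5/4\<close> bounds \<open>r\<close> away from \<open>1\<close>, where \<open>ln r\<close> vanishes. It is the value of \<open>\<rho> * D / \<epsilon>\<close> for
  \<open>I = 1\<close>, which is the smallest possible number of stages because \<open>\<epsilon> \<le> 2 * \<rho> * D\<close>.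
\<close>

lemma log_stages_le:
  fixes r :: real
  assumes "5/4 \<le> r"
  shows "log 2 (3/4 + r) \<le> 8 * ln r"
proof -
  have "3/4 + r \<le> r ^ 4"
  proof -
    have "(5/4) ^ 3 * r \<le> r ^ 3 * r"
      using assms by (intro mult_right_mono power_mono) auto
    moreover have "(5/4) ^ 3 * r = 125/64 * r" by (simp add: power3_eq_cube)
    moreover have "r ^ 3 * r = r ^ 4" by (simp add: eval_nat_numeral)
    ultimately show ?thesis using assms by linarith
  qed
  then have "ln (3/4 + r) \<le> ln (r ^ 4)"
    using assms by (subst ln_le_cancel_iff) auto
  also have "\<dots> = 4 * ln r"
    using assms by (simp add: ln_realpow)
  finally have le: "ln (3/4 + r) \<le> 4 * ln r" .
  have half: "1/2 \<le> ln (2::real)"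
    using ln2_ge_two_thirds by simp
  have "ln (3/4 + r) / ln 2 \<le> 4 * ln r / ln 2"
    using le half by (intro divide_right_mono) auto
  also have "\<dots> \<le> 4 * ln r / (1/2)"
    using half assms by (intro divide_left_mono) auto
  finally show ?thesis by (simp add: log_def)
qed

lemma stages_positive:
  fixes \<rho> D \<epsilon> :: real
  assumes "0 < \<epsilon>" "\<epsilon> \<le> 2 * \<rho> * D" "real I = log 2 (3/4 + \<rho> * D / \<epsilon>)"
  shows "1 \<le> I" "2 ^ I = 3/4 + \<rho> * D / \<epsilon>" "5/4 \<le> \<rho> * D / \<epsilon>"
proof -
  have half: "1/2 \<le> \<rho> * D / \<epsilon>" using assms(1,2) by (simp add: field_simps)
  then have "0 < log 2 (3/4 + \<rho> * D / \<epsilon>)" by (subst zero_less_log_cancel_iff) auto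
  then show I: "1 \<le> I" using assms(3) by linarith
  have "2 powr (real I) = 3/4 + \<rho> * D / \<epsilon>" unfolding assms(3) using half by simp
  then show eq: "2 ^ I = 3/4 + \<rho> * D / \<epsilon>" by (simp add: powr_realpow)
  have "(2::real) ^ 1 \<le> 2 ^ I" using I by (intro power_increasing) auto
  then show "5/4 \<le> \<rho> * D / \<epsilon>" unfolding eq power_one_right by linarith
qed

text \<open>
  The constant is \<open>2 * 6272 * 3 * 8 ^ 3\<close>: the factor \<open>2\<close> comes from \<open>I + 1 \<le> 2 * I\<close>, the factor \<open>3\<close>
  from the bound on the second moment, and \<open>8\<close> from the comparison of the two logarithms.
\<close>

lemma complexity_bound:
  fixes L D \<rho> \<epsilon> :: real
  assumes "0 < \<epsilon>" "\<epsilon> \<le> 2 * \<rho> * D" "real I = log 2 (3/4 + \<rho> * D / \<epsilon>)"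
  shows "real ((I + 1) * (gr_horizon L D \<rho> \<epsilon> - 1))
    \<le> 19267584 * ((ln (\<rho> * D / \<epsilon>)) ^ 3 * (L\<^sup>2 + \<rho>\<^sup>2 * D\<^sup>2) / \<epsilon>\<^sup>2)"
proof -
  note stages = stages_positive[OF assms]
  define c where "c = L\<^sup>2 + \<rho>\<^sup>2 * D\<^sup>2"
  define x where "x = ln (\<rho> * D / \<epsilon>)"
  have c: "0 \<le> c" by (simp add: c_def)
  have I: "real I \<le> 8 * x" using log_stages_le[OF stages(3)] by (simp add: assms(3) x_def)
  have "real (gr_horizon L D \<rho> \<epsilon> - 1) \<le> 6272 * (real I)\<^sup>2 * (2 * L\<^sup>2 + 3 * \<rho>\<^sup>2 * D\<^sup>2) / \<epsilon>\<^sup>2"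
    unfolding assms(3) using assms(1) by (rule gr_horizon_le) (simp add: assms(3)[symmetric])
  also have "\<dots> \<le> 6272 * (real I)\<^sup>2 * (3 * c) / \<epsilon>\<^sup>2"
    by (intro divide_right_mono mult_left_mono) (auto simp: c_def)
  finally have "real (I + 1) * real (gr_horizon L D \<rho> \<epsilon> - 1) \<le> (2 * real I) * (6272 * (real I)\<^sup>2 * (3 * c) / \<epsilon>\<^sup>2)"
    using stages(1) c by (intro mult_mono) auto
  also have "\<dots> = 37632 * ((real I) ^ 3 * c / \<epsilon>\<^sup>2)"
    by (simp add: power2_eq_square power3_eq_cube)
  also have "\<dots> \<le> 37632 * ((8 * x) ^ 3 * c / \<epsilon>\<^sup>2)"
    using I c by (intro mult_left_mono divide_right_mono mult_right_mono power_mono) auto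
  also have "\<dots> = 19267584 * (x ^ 3 * c / \<epsilon>\<^sup>2)"
    by (simp add: power_mult_distrib)
  finally show ?thesis unfolding c_def x_def of_nat_mult .
qed

section \<open>The convergence guarantee\<close>

theorem theorem1p7:
  fixes X U :: "'a::euclidean_space set"
    and g :: "'a \<Rightarrow> real"
    and M :: "'w measure"
    and G :: "'a \<Rightarrow> 'w \<Rightarrow> 'a"
    and Q :: "'q measure"
    and \<xi> :: "nat \<Rightarrow> 'q \<Rightarrow> 'w"
    and L D \<rho> \<epsilon> \<mu> l :: real
    and I :: nat
  assumes X: "X \<noteq> {}" "closed X" "convex X" "bounded X" "diameter X \<le> D" "0 < D"
    and g: "convex_on UNIV g" "\<exists>K. K-lipschitz_on UNIV g"
    and M: "prob_space M"
    and A1: "prob_space Q" "prob_space.indep_vars Q (\<lambda>_. M) \<xi> UNIV"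
      "\<And>n. distr Q M (\<xi> n) = M"
    and A2: "open U" "X \<subseteq> U"
      "(\<lambda>(x, v). G x v) \<in> borel_measurable (restrict_space borel U \<Otimes>\<^sub>M M)"
      "\<And>x. x \<in> U \<Longrightarrow> integrable M (G x)"
      "\<And>x. x \<in> U \<Longrightarrow> (\<integral>v. G x v \<partial>M) \<in> subdifferential g x"
    and A3: "0 \<le> L"
      "\<And>x. x \<in> X \<Longrightarrow> integrable M (\<lambda>v. (norm (G x v))\<^sup>2)"
      "\<And>x. x \<in> X \<Longrightarrow> (\<integral>v. (norm (G x v))\<^sup>2 \<partial>M) \<le> L\<^sup>2"
    and params: "0 < \<rho>" "0 < \<epsilon>" "\<epsilon> \<le> 2 * \<rho> * D"
      "\<mu> = \<epsilon> / (2 * D)" "l = 2 * \<rho> - \<epsilon> / (2 * D)"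
      "real I = log 2 (3/4 + \<rho> * D / \<epsilon>)"
  shows "let grad_env = grad (\<lambda>x. real_of_ereal (moreau_envelope (1 / (2 * \<rho>)) (restrict_to X g) x));
             run = (\<lambda>xc T \<omega>. gr X xc \<mu> l T I G (\<lambda>n. \<xi> n \<omega>))
         in
      (\<forall>T>0. \<forall>xc\<in>X.
            integrable Q (\<lambda>\<omega>. norm (grad_env (fst (run xc T \<omega>)))) \<and>
            (\<integral>\<omega>. norm (grad_env (fst (run xc T \<omega>))) \<partial>Q) \<le> gr_bound L D \<rho> \<epsilon> T)
    \<and> (let T = gr_horizon L D \<rho> \<epsilon>; N = (I + 1) * (T - 1) in
         0 < T \<and>
         (\<forall>xc\<in>X.
            (\<forall>\<omega>\<in>space Q. fst (run xc T \<omega>) \<in> X \<and> snd (run xc T \<omega>) = (N, N)) \<and>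
            integrable Q (\<lambda>\<omega>. norm (grad_env (fst (run xc T \<omega>)))) \<and>
            (\<integral>\<omega>. norm (grad_env (fst (run xc T \<omega>))) \<partial>Q) \<le> \<epsilon>))
    \<and> (\<exists>C>0. \<forall>(L'::real) (D'::real) (\<rho>'::real) (\<epsilon>'::real) (I'::nat).
         0 \<le> L' \<and> 0 < D' \<and> 0 < \<rho>' \<and> 0 < \<epsilon>' \<and> \<epsilon>' \<le> 2 * \<rho>' * D' \<and>
         real I' = log 2 (3/4 + \<rho>' * D' / \<epsilon>') \<longrightarrow>
         real ((I' + 1) * (gr_horizon L' D' \<rho>' \<epsilon>' - 1))
           \<le> C * ((ln (\<rho>' * D' / \<epsilon>')) ^ 3 * (L'\<^sup>2 + \<rho>'\<^sup>2 * D'\<^sup>2) / \<epsilon>'\<^sup>2))"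

proof -
  interpret Q: prob_space Q by (rule A1(1))
  interpret M: prob_space M by (rule M)
  obtain K where "K-lipschitz_on UNIV g" using g(2) by blast
  then have g_cont: "continuous_on UNIV g" by (rule lipschitz_on_continuous_on)
  interpret stochastic_oracle X g D Q U M G \<xi> L
    using X g(1) g_cont M A1 A2 A3 by unfold_locales auto
  note stages = stages_positive[OF params(2,3,6)]
  have \<mu>: "0 < \<mu>" using params X(6) by simp
  have \<mu>D: "\<mu> * D = \<epsilon> / 2" using params X(6) by simp
  have pow: "\<mu> * 2 ^ I = 3/4 * \<mu> + \<rho> / 2"
    unfolding stages(2) using params(1,2,4) X(6) by (simp add: field_simps)
  \<comment> \<open>That \<open>I\<close> is a positive integer improves \<open>\<mu> \<le> \<rho>\<close> to \<open>\<mu> \<le> 2/5 * \<rho>\<close>.\<close>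
  have "\<mu> * 2 \<le> \<mu> * 2 ^ I"
    using stages(1) \<mu> power_increasing[of 1 I "2::real"] by simp
  then have \<mu>_le: "5 * \<mu> \<le> 2 * \<rho>" using pow by linarith
  have l: "l = 2 * \<rho> - \<mu>" using params by simp
  have l_pos: "0 < l" using l \<mu>_le \<mu> by linarith
  \<comment> \<open>The shift by \<open>3/4\<close> in the definition of \<open>I\<close> is what makes the weights add up to \<open>2 * \<rho>\<close> exactly.\<close>
  have mod_I: "modulus \<mu> I = \<rho> + \<mu> / 2"
    using pow by (simp add: modulus_eq algebra_simps)
  have "modulus \<mu> I = \<mu> + (\<Sum>i=1..I. \<mu> * 2 ^ i)"
    unfolding modulus_def atMost_atLeast0 by (subst sum.atLeast_Suc_atMost) auto
  then have sum_eq: "(\<Sum>i=1..I. \<mu> * 2 ^ i) = l / 2"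
    using mod_I l by linarith
  define B where "B = sqrt (2 * L\<^sup>2 + 3 * \<rho>\<^sup>2 * D\<^sup>2)"
  have B_sq: "B\<^sup>2 = 2 * L\<^sup>2 + 3 * \<rho>\<^sup>2 * D\<^sup>2" by (simp add: B_def)
  have B_pos: "0 < B"
    unfolding B_def using params(1) X(6) by (intro real_sqrt_gt_zero add_nonneg_pos) auto
  \<comment> \<open>Here \<open>r\<close> bounds the shift of the oracle in all stages. As \<open>2 * (6/5)\<^sup>2 = 72/25 \<le> 3\<close>, it fits into the second moment bound \<open>B\<^sup>2\<close>.\<close>
  define r where "r = 6/5 * \<rho> * D"
  have r: "modulus \<mu> I * D \<le> r"
    unfolding r_def mod_I using \<mu>_le X(6) by (intro mult_right_mono) auto
  have B: "2 * L\<^sup>2 + 2 * r\<^sup>2 \<le> B\<^sup>2"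
  proof -
    have "r\<^sup>2 = 36/25 * (\<rho>\<^sup>2 * D\<^sup>2)"
      by (simp add: r_def power_mult_distrib power_divide)
    moreover have "0 \<le> \<rho>\<^sup>2 * D\<^sup>2" by simp
    ultimately show ?thesis unfolding B_sq by linarith
  qed
  have sum_2rho: "\<mu> + l = 2 * \<rho>" "modulus \<mu> I + l / 2 = 2 * \<rho>"
    using l mod_I by (linarith, linarith)
  have half_l: "0 \<le> l / 2" "l / 2 \<le> modulus \<mu> I"
    using l l_pos mod_I \<mu> by auto

  define grad_env where "grad_env = grad (\<lambda>x. real_of_ereal (moreau_envelope (1 / (2 * \<rho>)) (restrict_to X g) x))"
  define run where "run = (\<lambda>xc T \<omega>. gr X xc \<mu> l T I G (\<lambda>n. \<xi> n \<omega>))"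
  have run_eq: "run xc T \<omega> =
    ((1 / (2 * \<rho>)) *\<^sub>R (anchor X xc \<mu> G T (\<lambda>n. \<xi> n \<omega>) I + (l / 2) *\<^sub>R outer X xc \<mu> G T (\<lambda>n. \<xi> n \<omega>) (Suc I)),
     ((I + 1) * (T - 1), (I + 1) * (T - 1)))" for xc T \<omega>
    unfolding run_def gr_eq[OF sum_eq l_pos \<mu>] sum_2rho(1) ..
  have run_X: "fst (run xc T \<omega>) \<in> X" if "0 < T" "xc \<in> X" for xc T \<omega>
    unfolding run_eq fst_conv sum_2rho(2)[symmetric]
    using modulus_ge[OF \<mu>, of I] \<mu> half_l(1) run_in[OF that(2) \<mu> that(1)]
    by (intro weighted_mean_in) auto
  have main: "integrable Q (\<lambda>\<omega>. norm (grad_env (fst (run xc T \<omega>))))"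
    "(\<integral>\<omega>. norm (grad_env (fst (run xc T \<omega>))) \<partial>Q) \<le> gr_bound L D \<rho> \<epsilon> T"
    if T: "0 < T" and xc: "xc \<in> X" for xc T
  proof -
    let ?b = "\<lambda>\<omega>. anchor X xc \<mu> G T (\<lambda>n. \<xi> n \<omega>) I + (l / 2) *\<^sub>R outer X xc \<mu> G T (\<lambda>n. \<xi> n \<omega>) (Suc I)"
    have eq: "norm (grad_env (fst (run xc T \<omega>))) = norm (?b \<omega> - (2 * \<rho>) *\<^sub>R prox (2 * \<rho>) (?b \<omega>))" for \<omega>
      using params(1) unfolding grad_env_def run_eq fst_conv grad_moreau_envelope[OF params(1)] by simp
    note residual = final_residual[OF xc \<mu> T r B B_pos half_l, unfolded sum_2rho(2)]
    show "integrable Q (\<lambda>\<omega>. norm (grad_env (fst (run xc T \<omega>))))"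
      unfolding eq by (rule residual(1))
    have "(\<integral>\<omega>. norm (grad_env (fst (run xc T \<omega>))) \<partial>Q) \<le> \<epsilon> / 2 + (6 * real I + 4) * B / sqrt (real T + 1)"
      using residual(2) unfolding eq \<mu>D .
    also have "\<dots> \<le> \<epsilon> / 2 + (28 * sqrt 2 * real I) * B / sqrt (real T + 1)"
    proof -
      have "6 * real I + 4 \<le> 28 * 1 * real I" using stages(1) by simp
      also have "\<dots> \<le> 28 * sqrt 2 * real I" by (intro mult_right_mono mult_left_mono) auto
      finally show ?thesis using B_pos by (intro add_left_mono divide_right_mono mult_right_mono) auto
    qed
    also have "\<dots> = gr_bound L D \<rho> \<epsilon> T"
      by (simp add: gr_bound_def B_def params(6))
    finally show "(\<integral>\<omega>. norm (grad_env (fst (run xc T \<omega>))) \<partial>Q) \<le> gr_bound L D \<rho> \<epsilon> T" .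
  qed
  note horizon = gr_horizon_spec[OF params(2), of L D \<rho>]
  have guarantee: "\<forall>T>0. \<forall>xc\<in>X.
      integrable Q (\<lambda>\<omega>. norm (grad_env (fst (run xc T \<omega>)))) \<and>
      (\<integral>\<omega>. norm (grad_env (fst (run xc T \<omega>))) \<partial>Q) \<le> gr_bound L D \<rho> \<epsilon> T"
    by (intro allI ballI impI conjI main)
  have horizon_guarantee: "let T = gr_horizon L D \<rho> \<epsilon>; N = (I + 1) * (T - 1) in
      0 < T \<and>
      (\<forall>xc\<in>X.
         (\<forall>\<omega>\<in>space Q. fst (run xc T \<omega>) \<in> X \<and> snd (run xc T \<omega>) = (N, N)) \<and>
         integrable Q (\<lambda>\<omega>. norm (grad_env (fst (run xc T \<omega>)))) \<and>
         (\<integral>\<omega>. norm (grad_env (fst (run xc T \<omega>))) \<partial>Q) \<le> \<epsilon>)"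
    unfolding Let_def
  proof (intro conjI ballI)
    show "0 < gr_horizon L D \<rho> \<epsilon>" by (rule horizon(1))
    fix xc assume xc: "xc \<in> X"
    show "fst (run xc (gr_horizon L D \<rho> \<epsilon>) \<omega>) \<in> X" for \<omega>
      by (rule run_X[OF horizon(1) xc])
    show "snd (run xc (gr_horizon L D \<rho> \<epsilon>) \<omega>)
        = ((I + 1) * (gr_horizon L D \<rho> \<epsilon> - 1), (I + 1) * (gr_horizon L D \<rho> \<epsilon> - 1))" for \<omega>
      unfolding run_eq snd_conv ..
    show "integrable Q (\<lambda>\<omega>. norm (grad_env (fst (run xc (gr_horizon L D \<rho> \<epsilon>) \<omega>))))"
      by (rule main(1)[OF horizon(1) xc])
    show "(\<integral>\<omega>. norm (grad_env (fst (run xc (gr_horizon L D \<rho> \<epsilon>) \<omega>))) \<partial>Q) \<le> \<epsilon>"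
      by (rule order_trans[OF main(2)[OF horizon(1) xc] horizon(2)])
  qed
  have complexity: "\<exists>C>0. \<forall>(L'::real) (D'::real) (\<rho>'::real) (\<epsilon>'::real) (I'::nat).
      0 \<le> L' \<and> 0 < D' \<and> 0 < \<rho>' \<and> 0 < \<epsilon>' \<and> \<epsilon>' \<le> 2 * \<rho>' * D' \<and>
      real I' = log 2 (3/4 + \<rho>' * D' / \<epsilon>') \<longrightarrow>
      real ((I' + 1) * (gr_horizon L' D' \<rho>' \<epsilon>' - 1))
        \<le> C * ((ln (\<rho>' * D' / \<epsilon>')) ^ 3 * (L'\<^sup>2 + \<rho>'\<^sup>2 * D'\<^sup>2) / \<epsilon>'\<^sup>2)"
  proof (intro exI[of _ "19267584 :: real"] conjI allI impI; (elim conjE)?)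
    show "(0::real) < 19267584" by simp
  qed (rule complexity_bound)
  show ?thesis
    using conjI[OF guarantee conjI[OF horizon_guarantee complexity]]
    unfolding Let_def grad_env_def run_def .
qed

end
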